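(* Let $0<s<1$ and $\lambda\in\mathbb{R}$. Let $\Omega$ be a bounded or unbounded narrow region in $\Sigma_\lambda$, contained in $\{x\in\mathbb{R}^n\mid \lambda-2l<x_1<\lambda\}$ with $l>0$ small. Suppose that $w_\lambda\in C^{1,1}_{loc}(\Omega)\cap\mathcal{L}_{2s}(\mathbb{R}^n)$ is lower semi-continuous on $\bar\Omega$. Assume $$w_\lambda(x)\le o(1)\,|x|^\gamma\quad\text{for any }0<\gamma<2s,\text{ as }|x|\to+\infty,$$ and $$\begin{cases}(-\Delta)^s w_\lambda(x)+c_\lambda(x)\,w_\lambda(x)=0, & x\in\Omega,\\ w_\lambda(x)\ge0, & x\in\Sigma_\lambda\setminus\Omega,\\ w_\lambda(x^\lambda)=-w_\lambda(x), & x\in\Sigma_\lambda.\end{cases}$$ If $c_\lambda(x)$ is bounded from below, then for all sufficiently small $l$ (how small may depend on the lower bound of $c_\lambda$) we have $$w_\lambda(x)\ge0,\qquad x\in\Sigma_\lambda.$$ Furthermore, the following strong maximum principle holds: either $w_\lambda(x)>0$ for all $x\in\Omega$, or $w_\lambda(x)\equiv0$ for all $x\in\Omega$.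
   Context: Write $x=(x_1,x')\in\mathbb{R}^n$ with $x'\in\mathbb{R}^{n-1}$. For $\lambda\in\mathbb{R}$, $\Sigma_\lambda=\{x\in\mathbb{R}^n\mid x_1<\lambda\}$ and $x^\lambda=(2\lambda-x_1,x')$ is the reflection of $x$ about $\{x_1=\lambda\}$. The fractional Laplacian is $$(-\Delta)^s u(x)=C_{n,s}\,\lim_{\varepsilon\to0^+}\int_{\mathbb{R}^n\setminus B_\varepsilon(x)}\frac{u(x)-u(y)}{|x-y|^{n+2s}}\,dy,\qquad C_{n,s}=\left(\int_{\mathbb{R}^n}\frac{1-\cos(2\pi\zeta_1)}{|\zeta|^{n+2s}}d\zeta\right)^{-1}.$$ $\mathcal{L}_{2s}(\mathbb{R}^n)=\{u\in L^1_{loc}(\mathbb{R}^n)\mid\int_{\mathbb{R}^n}\frac{|u(x)|}{1+|x|^{n+2s}}dx<+\infty\}$. $o(1)$ denotes a quantity tending to $0$ as $|x|\to+\infty$. *)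

theory Defs
  imports "HOL-Analysis.Analysis"
begin

text \<open>
  Points of \<open>n\<close>-dimensional space have type \<^typ>\<open>real ^ 'n\<close>, with \<open>n = CARD('n)\<close>. The
  class \<open>one\<close> on the index type is purely syntactic (it carries no axioms): it singles out an
  index \<open>1\<close>, so that \<open>x $ 1\<close> is the first coordinate.
\<close>

definition half_space :: "real \<Rightarrow> (real ^ ('n::{finite,one})) set" where
  "half_space lam = {x. x $ 1 < lam}"

definition reflect :: "real \<Rightarrow> real ^ ('n::{finite,one}) \<Rightarrow> real ^ ('n::{finite,one})" where
  "reflect lam x = (\<chi> i. if i = 1 then 2 * lam - x $ 1 else x $ i)"

text \<open>
  The integrand below is \<open>0\<close> at the origin, by the convention \<open>a / 0 = 0\<close>; this is a null set.
\<close>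

definition frac_laplacian_const :: "('n::{finite,one}) itself \<Rightarrow> real \<Rightarrow> real" where
  "frac_laplacian_const _ s =
     inverse (LINT \<zeta>|lebesgue. (1 - cos (2 * pi * (\<zeta> :: real ^ ('n::{finite,one})) $ 1))
                              / norm \<zeta> powr (real CARD('n) + 2 * s))"

text \<open>
  The value is meaningful where the principal value limit exists, for instance at the points of an
  open set on which \<open>u\<close> is in \<open>C11_loc\<close>, if \<open>u\<close> lies in \<open>L_frac s\<close> below and
  \<open>0 < s < 1\<close>.
\<close>

definition frac_laplacian ::
    "real \<Rightarrow> (real ^ ('n::{finite,one}) \<Rightarrow> real) \<Rightarrow> real ^ ('n::{finite,one}) \<Rightarrow> real" where
  "frac_laplacian s u x =
     frac_laplacian_const TYPE('n) s *
     Lim (at_right 0) (\<lambda>\<epsilon>. LINT y:(UNIV - ball x \<epsilon>)|lebesgue.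
       (u x - u y) / norm (x - y) powr (real CARD('n) + 2 * s))"

definition L1_loc :: "('a::euclidean_space \<Rightarrow> real) set" where
  "L1_loc = {u. \<forall>K. compact K \<longrightarrow> u absolutely_integrable_on K}"

definition L_frac :: "real \<Rightarrow> (real ^ 'n \<Rightarrow> real) set" where
  "L_frac s = {u \<in> L1_loc.
     integrable lebesgue (\<lambda>x. \<bar>u x\<bar> / (1 + norm x powr (real CARD('n) + 2 * s)))}"

definition C11_loc :: "'a::euclidean_space set \<Rightarrow> ('a \<Rightarrow> real) set" where
  "C11_loc S = {u. \<exists>g. (\<forall>x\<in>S. GDERIV u x :> g x) \<and>
                     (\<forall>K. compact K \<and> K \<subseteq> S \<longrightarrow> (\<exists>L. lipschitz_on L K g))}"

definition lower_semicontinuous_on :: "'a::topological_space set \<Rightarrow> ('a \<Rightarrow> real) \<Rightarrow> bool" where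
  "lower_semicontinuous_on S u \<longleftrightarrow>
     (\<forall>x\<in>S. \<forall>a<u x. eventually (\<lambda>y. a < u y) (at x within S))"

end

theory Submission
  imports Defs
begin

text \<open>
  Write \<open>K\<close> for the kernel \<open>z \<mapsto> norm z powr - (n + 2 * s)\<close>. Folding space along the hyperplane
  \<open>x $ 1 = lam\<close>, an antisymmetric function \<open>w\<close> satisfies, up to a positive factor,

  \<open>(-\<Delta>)\<^sup>s w(x) = PV \<integral> (w x - w y) * K(x - y) + (w x + w y) * K(x - reflect lam y) dy\<close>

  with the integral over the half space, where \<open>K(x - reflect lam y) < K(x - y)\<close>. So the
  right-hand side decreases when the values \<open>w y\<close> increase. If \<open>w\<close> had a negative minimum at \<open>x\<close>,
  replacing \<open>w y\<close> by \<open>w x\<close> would leave \<open>2 * w x\<close> times the mass of the kernel beyond the hyperplane,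
  which is of order \<open>w x * d powr - (2 * s)\<close> for \<open>d\<close> the distance from \<open>x\<close> to the hyperplane. In a
  narrow region \<open>d\<close> is small, and this negative term beats \<open>\<bar>C\<bar> * \<bar>w x\<bar>\<close>, the most that the equation
  allows.

  The minimum need not exist: \<open>w\<close> may decrease without bound at infinity, though slower than
  \<open>- norm x powr \<gamma>\<close>, and its infimum may be approached at the hyperplane. Both difficulties are
  met by using an almost minimal point. First, \<open>w\<close> is divided by a weight
  \<open>M + norm x powr \<gamma>\<close>, where a large \<open>M\<close> makes the oscillation of the weight negligible at unit
  scale (\<open>power_weight_growth\<close>); since \<open>M\<close> may depend on \<open>\<gamma>\<close>, the admissible width does not.
  Secondly, at an almost minimal point \<open>x0\<close> of the quotient, a paraboloid of height comparable to
  the small error, opened at the scale of the distance to the hyperplane, touches \<open>w\<close> from below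
  at some \<open>x\<close> near \<open>x0\<close> (\<open>touching_point_near\<close>). At \<open>x\<close> the errors coming from the weight, from the
  almost minimality and from the paraboloid are all small multiples of \<open>\<bar>w x\<bar> * d powr - (2 * s)\<close>,
  so the argument for a true minimum persists (\<open>pv_integral_upper_bound\<close>, \<open>negative_value_needs_width\<close>).

  To compute at a touching point, the principal value is rewritten as an absolutely convergent
  integral by subtracting the linear part of \<open>w\<close>, whose gradient is that of the paraboloid
  (\<open>frac_laplacian_touching_below\<close>). Once \<open>w\<close> is nonnegative, a zero in \<open>\<Omega>\<close> makes the
  folded integrand of one sign with vanishing integral (\<open>strong_maximum_principle\<close>).
\<close>

section \<open>Reflections and powers of the norm under Lebesgue measure\<close>

text \<open>
  Both the reflection \<open>reflect lam\<close> and the point reflections \<open>y \<mapsto> a - y\<close> flip some coordinates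
  and translate, so one change of variables serves for both.
\<close>

lemma lebesgue_signed_translation:
  fixes c :: "'a::euclidean_space \<Rightarrow> real" and t :: 'a
  defines "T \<equiv> (\<lambda>x. t + (\<Sum>j\<in>Basis. (c j * (x \<bullet> j)) *\<^sub>R j))"
  assumes c: "\<And>j. j \<in> Basis \<Longrightarrow> \<bar>c j\<bar> = 1"
  shows "T \<in> lebesgue \<rightarrow>\<^sub>M lebesgue" and "distr lebesgue lebesgue T = lebesgue"
proof -
  have nz: "c j \<noteq> 0" if "j \<in> Basis" for j
    using c[OF that] by auto
  show "T \<in> lebesgue \<rightarrow>\<^sub>M lebesgue"
    unfolding T_def by (rule lebesgue_affine_measurable) (rule nz)
  have "lebesgue = density (distr lebesgue lebesgue T) (\<lambda>_. (\<Prod>j\<in>Basis. \<bar>c j\<bar>))"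
    unfolding T_def by (rule lebesgue_affine_euclidean) (rule nz)
  also have "(\<Prod>j\<in>Basis. \<bar>c j\<bar>) = 1"
    by (rule prod.neutral) (use c in auto)
  finally show "distr lebesgue lebesgue T = lebesgue"
    by (simp add: density_1)
qed

lemma lebesgue_point_reflection:
  fixes a :: "'a::euclidean_space"
  shows "(\<lambda>y. a - y) \<in> lebesgue \<rightarrow>\<^sub>M lebesgue"
    and "distr lebesgue lebesgue (\<lambda>y. a - y) = lebesgue"
proof -
  have eq: "(\<lambda>y. a + (\<Sum>j\<in>Basis. ((- 1) * (y \<bullet> j)) *\<^sub>R j)) = (\<lambda>y. a - y)"
    by (simp add: sum_negf euclidean_representation)
  show "(\<lambda>y. a - y) \<in> lebesgue \<rightarrow>\<^sub>M lebesgue"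
    and "distr lebesgue lebesgue (\<lambda>y. a - y) = lebesgue"
    using lebesgue_signed_translation[of "\<lambda>_. - 1" a] unfolding eq by auto
qed

lemma lebesgue_reflect:
  shows "(reflect lam :: (real, 'n::{finite,one}) vec \<Rightarrow> (real, 'n) vec) \<in> lebesgue \<rightarrow>\<^sub>M lebesgue"
    and "distr lebesgue lebesgue (reflect lam :: (real, 'n) vec \<Rightarrow> (real, 'n) vec) = lebesgue"
proof -
  let ?e = "axis 1 1 :: (real, 'n) vec"
  have eq: "(\<lambda>y. (2 * lam) *\<^sub>R ?e + (\<Sum>j\<in>Basis. ((if j = ?e then - 1 else 1) * (y \<bullet> j)) *\<^sub>R j)) = reflect lam"
  proof
    fix y :: "(real, 'n) vec"
    have "(\<Sum>j\<in>Basis. ((if j = ?e then - 1 else 1) * (y \<bullet> j)) *\<^sub>R j)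
        = (\<Sum>j\<in>Basis. (y \<bullet> j) *\<^sub>R j - (if j = ?e then (2 * (y \<bullet> j)) *\<^sub>R j else 0))"
      by (rule sum.cong) (auto simp: scaleR_2 algebra_simps simp flip: scaleR_scaleR)
    also have "\<dots> = y - (2 * (y \<bullet> ?e)) *\<^sub>R ?e"
      unfolding sum_subtractf by (simp add: euclidean_representation sum.delta axis_in_Basis_iff)
    finally show "(2 * lam) *\<^sub>R ?e + (\<Sum>j\<in>Basis. ((if j = ?e then - 1 else 1) * (y \<bullet> j)) *\<^sub>R j)
        = reflect lam y"
      by (simp add: vec_eq_iff reflect_def inner_axis) (simp add: axis_def)
  qed
  show "(reflect lam :: (real, 'n) vec \<Rightarrow> _) \<in> lebesgue \<rightarrow>\<^sub>M lebesgue"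
    and "distr lebesgue lebesgue (reflect lam :: (real, 'n) vec \<Rightarrow> _) = lebesgue"
    using lebesgue_signed_translation[of "\<lambda>j. if j = ?e then - 1 else 1" "(2 * lam) *\<^sub>R ?e"]
    unfolding eq by auto
qed

lemma integral_measure_preserving:
  fixes f :: "'a \<Rightarrow> real"
  assumes T: "T \<in> M \<rightarrow>\<^sub>M M" and d: "distr M M T = M" and f: "integrable M f"
  shows "integrable M (\<lambda>y. f (T y))" and "(LINT y|M. f (T y)) = (LINT y|M. f y)"
proof -
  show "integrable M (\<lambda>y. f (T y))"
    using T f by (intro integrable_distr[of T M M]) (simp_all add: d)
  have "(LINT y|M. f (T y)) = (LINT y|distr M M T. f y)"
    using T f by (intro integral_distr[symmetric]) auto
  then show "(LINT y|M. f (T y)) = (LINT y|M. f y)"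
    by (simp add: d)
qed

lemma dyadic_shell:
  fixes t :: real
  assumes "1 \<le> t"
  obtains k where "2 ^ k \<le> t" "t < 2 ^ Suc k"
proof -
  obtain n where n: "t < 2 ^ n"
    using real_arch_pow[of 2 t] by auto
  define m where "m = (LEAST n. t < 2 ^ n)"
  have m: "t < 2 ^ m"
    unfolding m_def by (rule LeastI) (rule n)
  then have "m \<noteq> 0"
    using assms by (metis not_less power_0)
  then obtain k where k: "m = Suc k"
    using not0_implies_Suc by blast
  have "\<not> t < 2 ^ k"
    using not_less_Least[of k "\<lambda>n. t < 2 ^ n"] k unfolding m_def by auto
  with m k that show thesis
    by (auto simp: not_less)
qed

text \<open>
  On a shell \<open>R / 2 \<le> norm z \<le> R\<close> the integrand is comparable to \<open>R powr (a - n)\<close> and the shell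
  lies in a ball of volume proportional to \<open>R ^ n\<close>, so each shell contributes a multiple of
  \<open>R powr a\<close>. Dyadic radii then turn the integrals of powers of the norm into geometric series,
  which give at the same time the integrability and the scaling in the radius.
\<close>

lemma radial_power_integral_shells:
  fixes S :: "'a::euclidean_space set" and a :: real and R :: "nat \<Rightarrow> real"
  assumes S: "S \<in> sets borel" and R: "\<And>k. 0 < R k" and sm: "summable (\<lambda>k. R k powr a)"
    and cover: "\<And>z. z \<in> S \<Longrightarrow> z \<noteq> 0 \<Longrightarrow> \<exists>k. R k / 2 \<le> norm z \<and> norm z \<le> R k"
  defines "D \<equiv> 2 powr (\<bar>a\<bar> + DIM('a)) * unit_ball_vol (DIM('a))"
  shows "integrable lebesgue (\<lambda>z. indicator S z * norm z powr (a - DIM('a)))"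
    and "(LINT z|lebesgue. indicator S z * norm z powr (a - DIM('a))) \<le> D * (\<Sum>k. R k powr a)"
proof -
  let ?n = "real DIM('a)"
  define f where "f = (\<lambda>z::'a. indicator S z * norm z powr (a - ?n))"
  define c where "c = (\<lambda>k. 2 powr (\<bar>a\<bar> + ?n) * R k powr (a - ?n))"
  have c0: "0 \<le> c k" for k unfolding c_def by simp
  have D0: "0 \<le> D" unfolding D_def by simp
  have [measurable]: "S \<in> sets borel" by fact
  have [measurable]: "cball (0::'a) (R k) \<in> sets borel" for k by simp
  have fm: "f \<in> borel_measurable lebesgue"
    unfolding f_def by (rule measurable_completion) measurable
  have single: "h k \<le> (\<Sum>k. h k)" for h :: "nat \<Rightarrow> ennreal" and k
    using sum_le_suminf[of h "{k}"] by simp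
  have pt: "ennreal (f z) \<le> (\<Sum>k. ennreal (c k) * indicator (cball (0::'a) (R k)) z)" for z
  proof (cases "z \<in> S \<and> z \<noteq> 0")
    case True
    then obtain k where k: "R k / 2 \<le> norm z" "norm z \<le> R k"
      using cover by blast
    have z0: "0 < norm z" using True by simp
    let ?q = "norm z / R k"
    have q: "1 / 2 \<le> ?q" "?q \<le> 1" using k R[of k] by (auto simp: field_simps)
    have "?q powr (a - ?n) \<le> (1 / 2) powr - (\<bar>a\<bar> + ?n)"
    proof -
      have "?q powr (a - ?n) \<le> ?q powr - (\<bar>a\<bar> + ?n)"
        using q by (intro powr_mono') linarith+
      also have "\<dots> \<le> (1 / 2) powr - (\<bar>a\<bar> + ?n)"
        using q by (intro powr_mono2') simp_all
      finally show ?thesis .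
    qed
    also have "(1 / 2 :: real) powr - t = 2 powr t" for t
      by (simp add: powr_minus powr_divide)
    finally have le: "norm z powr (a - ?n) \<le> c k"
      using R[of k] z0 unfolding c_def by (simp add: powr_divide field_simps)
    have "ennreal (f z) \<le> ennreal (c k) * indicator (cball (0::'a) (R k)) z"
      using le True k unfolding f_def by (auto simp: indicator_def intro!: ennreal_leI)
    also have "\<dots> \<le> (\<Sum>k. ennreal (c k) * indicator (cball (0::'a) (R k)) z)"
      by (rule single)
    finally show ?thesis .
  next
    case False
    then have "f z = 0" unfolding f_def by (auto simp: indicator_def)
    then show ?thesis by simp
  qed
  have ck: "c k * (unit_ball_vol ?n * R k ^ DIM('a)) = D * R k powr a" for k
    using R[of k] unfolding c_def D_def
    by (simp add: powr_diff powr_realpow)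
  have "(\<integral>\<^sup>+z. ennreal (f z) \<partial>lebesgue) \<le> (\<integral>\<^sup>+z. (\<Sum>k. ennreal (c k) * indicator (cball (0::'a) (R k)) z) \<partial>lebesgue)"
    by (intro nn_integral_mono pt)
  also have "\<dots> = (\<Sum>k. \<integral>\<^sup>+z. ennreal (c k) * indicator (cball (0::'a) (R k)) z \<partial>lebesgue)"
    by (intro nn_integral_suminf measurable_completion) measurable
  also have "\<dots> = (\<Sum>k. ennreal (D * R k powr a))"
  proof (rule suminf_cong)
    fix k
    have "(\<integral>\<^sup>+z. ennreal (c k) * indicator (cball (0::'a) (R k)) z \<partial>lebesgue) = ennreal (c k) * emeasure lebesgue (cball (0::'a) (R k))"
      by (rule nn_integral_cmult_indicator) auto
    also have "\<dots> = ennreal (D * R k powr a)"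
      using R[of k] c0[of k] ck[of k] by (simp add: emeasure_cball ennreal_mult'[symmetric])
    finally show "(\<integral>\<^sup>+z. ennreal (c k) * indicator (cball (0::'a) (R k)) z \<partial>lebesgue) = ennreal (D * R k powr a)" .
  qed
  also have "\<dots> = ennreal (\<Sum>k. D * R k powr a)"
    using sm D0 by (intro suminf_ennreal2 summable_mult) auto
  also have "(\<Sum>k. D * R k powr a) = D * (\<Sum>k. R k powr a)"
    using sm by (rule suminf_mult)
  finally have bd: "(\<integral>\<^sup>+z. ennreal (f z) \<partial>lebesgue) \<le> ennreal (D * (\<Sum>k. R k powr a))" .
  have f0: "0 \<le> f z" for z unfolding f_def by simp
  show "integrable lebesgue (\<lambda>z. indicator S z * norm z powr (a - ?n))"
    unfolding f_def[symmetric] using fm f0 bd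
    by (intro integrableI_nonneg) (auto simp: less_top[symmetric] top_unique)
  show "(LINT z|lebesgue. indicator S z * norm z powr (a - ?n)) \<le> D * (\<Sum>k. R k powr a)"
    unfolding f_def[symmetric]
    by (rule integral_real_bounded)
       (use bd D0 sm in \<open>auto intro!: mult_nonneg_nonneg suminf_nonneg\<close>)
qed

lemma radial_power_near:
  fixes a :: real
  assumes "0 < a"
  shows "\<exists>N>0. \<forall>r>0. integrable lebesgue (\<lambda>z::'a::euclidean_space. indicator (cball 0 r) z * norm z powr (a - DIM('a)))
    \<and> (LINT z|lebesgue. indicator (cball 0 r) (z::'a) * norm z powr (a - DIM('a))) \<le> N * r powr a"
proof -
  define D where "D = 2 powr (\<bar>a\<bar> + DIM('a)) * unit_ball_vol (DIM('a))"
  define G where "G = (\<Sum>k. (2 powr - a) ^ k)"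
  have q: "norm (2 powr - a :: real) < 1"
    using assms by (simp add: powr_less_one)
  have G: "0 < G"
    unfolding G_def using q by (intro suminf_pos summable_geometric) auto
  have D: "0 < D" unfolding D_def by simp
  have pw: "(r / 2 ^ k) powr a = r powr a * (2 powr - a) ^ k" if "0 < r" for r k
    using that by (simp add: powr_divide powr_minus powr_power powr_realpow[symmetric] powr_powr field_simps)
  have sh: "integrable lebesgue (\<lambda>z::'a. indicator (cball 0 r) z * norm z powr (a - DIM('a)))
      \<and> (LINT z|lebesgue. indicator (cball 0 r) (z::'a) * norm z powr (a - DIM('a))) \<le> (D * G) * r powr a"
    if r: "0 < r" for r
  proof -
    have sm: "summable (\<lambda>k. (r / 2 ^ k) powr a)"
      unfolding pw[OF r] using q by (intro summable_mult summable_geometric)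
    have eq: "(\<Sum>k. (r / 2 ^ k) powr a) = r powr a * G"
      unfolding pw[OF r] G_def using q by (intro suminf_mult summable_geometric)
    have cov: "\<exists>k. r / 2 ^ k / 2 \<le> norm z \<and> norm z \<le> r / 2 ^ k"
      if "z \<in> cball 0 r" "z \<noteq> 0" for z :: 'a
    proof -
      have "1 \<le> r / norm z" using that by simp
      then obtain k where "2 ^ k \<le> r / norm z" "r / norm z < 2 ^ Suc k"
        by (rule dyadic_shell)
      then show ?thesis
        using that by (intro exI[of _ k]) (auto simp: field_simps)
    qed
    show ?thesis
      using radial_power_integral_shells[of "cball 0 r" "\<lambda>k. r / 2 ^ k" a, OF _ _ sm cov] r
      unfolding D_def[symmetric] eq by (simp add: mult.commute mult.left_commute)
  qed
  show ?thesis
    by (rule exI[of _ "D * G"]) (use sh D G in auto)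
qed

lemma radial_power_tail:
  fixes p :: real
  assumes "0 < p"
  shows "\<exists>T>0. \<forall>r>0. integrable lebesgue (\<lambda>z::'a::euclidean_space. indicator (- ball 0 r) z * norm z powr (- p - DIM('a)))
    \<and> (LINT z|lebesgue. indicator (- ball 0 r) (z::'a) * norm z powr (- p - DIM('a))) \<le> T * r powr - p"
proof -
  define D where "D = 2 powr (\<bar>- p\<bar> + DIM('a)) * unit_ball_vol (DIM('a))"
  define G where "G = (\<Sum>k. 2 powr - p * (2 powr - p) ^ k)"
  have q: "norm (2 powr - p :: real) < 1"
    using assms by (simp add: powr_less_one)
  have G: "0 < G"
    unfolding G_def using q by (intro suminf_pos summable_mult summable_geometric) auto
  have D: "0 < D" unfolding D_def by simp
  have pw: "(r * 2 ^ Suc k) powr - p = r powr - p * (2 powr - p * (2 powr - p) ^ k)" if "0 < r" for r k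
    using that by (simp add: powr_mult powr_minus powr_power powr_realpow[symmetric] powr_powr powr_add field_simps)
  have sh: "integrable lebesgue (\<lambda>z::'a. indicator (- ball 0 r) z * norm z powr (- p - DIM('a)))
      \<and> (LINT z|lebesgue. indicator (- ball 0 r) (z::'a) * norm z powr (- p - DIM('a))) \<le> (D * G) * r powr - p"
    if r: "0 < r" for r
  proof -
    have sm: "summable (\<lambda>k. (r * 2 ^ Suc k) powr - p)"
      unfolding pw[OF r] using q by (intro summable_mult summable_geometric)
    have eq: "(\<Sum>k. (r * 2 ^ Suc k) powr - p) = r powr - p * G"
      unfolding pw[OF r] G_def using q by (intro suminf_mult summable_mult summable_geometric)
    have cov: "\<exists>k. r * 2 ^ Suc k / 2 \<le> norm z \<and> norm z \<le> r * 2 ^ Suc k"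
      if "z \<in> - ball 0 r" "z \<noteq> 0" for z :: 'a
    proof -
      have "1 \<le> norm z / r" using that r by simp
      then obtain k where "2 ^ k \<le> norm z / r" "norm z / r < 2 ^ Suc k"
        by (rule dyadic_shell)
      then show ?thesis
        using that r by (intro exI[of _ k]) (auto simp: field_simps)
    qed
    show ?thesis
      using radial_power_integral_shells[of "- ball 0 r" "\<lambda>k. r * 2 ^ Suc k" "- p", OF _ _ sm cov] r
      unfolding D_def[symmetric] eq by (simp add: mult.commute mult.left_commute)
  qed
  show ?thesis
    by (rule exI[of _ "D * G"]) (use sh D G in auto)
qed

section \<open>The fractional Laplacian as an absolutely convergent integral\<close>

text \<open>
  The kernel is written with a negative exponent, so that it vanishes at the origin; integrands
  then need no separate case for the centre.
\<close>

definition frac_kernel :: "real \<Rightarrow> (real, 'n::finite) vec \<Rightarrow> real" where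
  "frac_kernel s z = norm z powr (- (real CARD('n) + 2 * s))"

lemma frac_kernel_nonneg [simp]: "0 \<le> frac_kernel s z"
  by (simp add: frac_kernel_def)

lemma frac_kernel_zero [simp]: "frac_kernel s 0 = 0"
  by (simp add: frac_kernel_def)

lemma divide_eq_frac_kernel:
  fixes z :: "(real, 'n::finite) vec"
  shows "a / norm z powr (real CARD('n) + 2 * s) = a * frac_kernel s z"
  unfolding frac_kernel_def powr_minus divide_inverse by (rule refl)

lemma frac_kernel_measurable [measurable]: "frac_kernel s \<in> borel_measurable borel"
  unfolding frac_kernel_def by measurable

lemma frac_kernel_shift_measurable: "(\<lambda>y. frac_kernel s (x - y)) \<in> borel_measurable lebesgue"
  by (rule measurable_completion) measurable

lemma inner_shift_measurable:
  fixes v x :: "'a::euclidean_space"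
  shows "(\<lambda>y. v \<bullet> (y - x)) \<in> borel_measurable lebesgue"
  by (rule measurable_completion) (simp add: borel_measurable_continuous_onI continuous_intros)

lemma frac_kernel_tail:
  fixes s q :: real
  assumes "q < 2 * s"
  shows "\<exists>T>0. \<forall>(x :: (real, 'n::finite) vec). \<forall>r>0.
      integrable lebesgue (\<lambda>y. indicator (- ball x r) y * (norm (y - x) powr q * frac_kernel s (x - y))) \<and>
      (LINT y|lebesgue. indicator (- ball x r) y * (norm (y - x) powr q * frac_kernel s (x - y))) \<le> T * r powr (q - 2 * s)"
proof -
  have eq: "indicator (- ball x r) y * (norm (y - x) powr q * frac_kernel s (x - y))
      = indicator (- ball 0 r) (x - y) * norm (x - y) powr (- (2 * s - q) - DIM((real,'n) vec))"
    for x y :: "(real,'n) vec" and r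
    by (auto simp: indicator_def frac_kernel_def dist_norm norm_minus_commute powr_add[symmetric] algebra_simps)
  have "0 < 2 * s - q" using assms by simp
  from radial_power_tail[OF this, where 'a = "(real, 'n) vec"] show ?thesis
  proof (elim exE conjE)
    fix T :: real
    assume "0 < T" and T:
      "\<forall>r>0. integrable lebesgue (\<lambda>z::(real,'n) vec. indicator (- ball 0 r) z * norm z powr (- (2 * s - q) - DIM((real,'n) vec))) \<and>
        (LINT z|lebesgue. indicator (- ball 0 r) (z::(real,'n) vec) * norm z powr (- (2 * s - q) - DIM((real,'n) vec))) \<le> T * r powr - (2 * s - q)"
    show ?thesis
    proof (intro exI[of _ T] conjI \<open>0 < T\<close> allI impI)
      fix x :: "(real,'n) vec" and r :: real assume r: "0 < r"
      note mp = integral_measure_preserving[OF lebesgue_point_reflection[of x] conjunct1[OF T[rule_format, OF r]]]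
      show "integrable lebesgue (\<lambda>y. indicator (- ball x r) y * (norm (y - x) powr q * frac_kernel s (x - y)))"
        unfolding eq by (rule mp(1))
      show "(LINT y|lebesgue. indicator (- ball x r) y * (norm (y - x) powr q * frac_kernel s (x - y))) \<le> T * r powr (q - 2 * s)"
        unfolding eq mp(2) using T[rule_format, OF r] by simp
    qed
  qed
qed

lemma frac_kernel_near:
  fixes s :: real
  assumes "s < 1"
  shows "\<exists>N>0. \<forall>(x :: (real, 'n::finite) vec). \<forall>r>0.
      integrable lebesgue (\<lambda>y. indicator (cball x r) y * ((norm (y - x))\<^sup>2 * frac_kernel s (x - y))) \<and>
      (LINT y|lebesgue. indicator (cball x r) y * ((norm (y - x))\<^sup>2 * frac_kernel s (x - y))) \<le> N * r powr (2 - 2 * s)"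
proof -
  have eq: "indicator (cball x r) y * ((norm (y - x))\<^sup>2 * frac_kernel s (x - y))
      = indicator (cball 0 r) (x - y) * norm (x - y) powr (2 - 2 * s - DIM((real,'n) vec))"
    for x y :: "(real,'n) vec" and r
  proof (cases "x = y")
    case False
    have "(norm (y - x))\<^sup>2 = norm (x - y) powr 2"
      using False by (simp add: norm_minus_commute)
    then have "(norm (y - x))\<^sup>2 * frac_kernel s (x - y) = norm (x - y) powr (2 - 2 * s - DIM((real,'n) vec))"
      by (simp only: frac_kernel_def powr_add[symmetric]) (simp add: algebra_simps)
    then show ?thesis
      by (auto simp: indicator_def dist_norm norm_minus_commute)
  qed simp
  have "0 < 2 - 2 * s" using assms by simp
  from radial_power_near[OF this, where 'a = "(real, 'n) vec"] show ?thesis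
  proof (elim exE conjE)
    fix N :: real
    assume "0 < N" and N:
      "\<forall>r>0. integrable lebesgue (\<lambda>z::(real,'n) vec. indicator (cball 0 r) z * norm z powr (2 - 2 * s - DIM((real,'n) vec))) \<and>
        (LINT z|lebesgue. indicator (cball 0 r) (z::(real,'n) vec) * norm z powr (2 - 2 * s - DIM((real,'n) vec))) \<le> N * r powr (2 - 2 * s)"
    show ?thesis
    proof (intro exI[of _ N] conjI \<open>0 < N\<close> allI impI)
      fix x :: "(real,'n) vec" and r :: real assume r: "0 < r"
      note mp = integral_measure_preserving[OF lebesgue_point_reflection[of x] conjunct1[OF N[rule_format, OF r]]]
      show "integrable lebesgue (\<lambda>y. indicator (cball x r) y * ((norm (y - x))\<^sup>2 * frac_kernel s (x - y)))"
        unfolding eq by (rule mp(1))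
      show "(LINT y|lebesgue. indicator (cball x r) y * ((norm (y - x))\<^sup>2 * frac_kernel s (x - y))) \<le> N * r powr (2 - 2 * s)"
        unfolding eq mp(2) using N[rule_format, OF r] by simp
    qed
  qed
qed

lemma frac_kernel_mass_tail:
  fixes s :: real
  assumes "0 < s"
  shows "\<exists>T>0. \<forall>(x :: (real, 'n::finite) vec). \<forall>r>0.
      integrable lebesgue (\<lambda>y. indicator (- ball x r) y * frac_kernel s (x - y)) \<and>
      (LINT y|lebesgue. indicator (- ball x r) y * frac_kernel s (x - y)) \<le> T * r powr - (2 * s)"
proof -
  have eq: "indicator (- ball x r) y * (norm (y - x) powr 0 * frac_kernel s (x - y))
      = indicator (- ball x r) y * frac_kernel s (x - y)" for x y :: "(real, 'n) vec" and r :: real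
    by simp
  have "0 < 2 * s" using assms by simp
  from frac_kernel_tail[OF this, where 'n = 'n] show ?thesis
    unfolding eq by simp
qed

lemma frac_kernel_tail_integrable:
  fixes x :: "(real, 'n::finite) vec"
  assumes "0 < s" "0 < r"
  shows "integrable lebesgue (\<lambda>y. indicator (- ball x r) y * frac_kernel s (x - y))"
  using frac_kernel_mass_tail[OF assms(1), where 'n = 'n] assms(2) by auto

lemma L_frac_measurable:
  fixes u :: "(real, 'n::finite) vec \<Rightarrow> real"
  assumes "u \<in> L_frac s"
  shows "u \<in> borel_measurable lebesgue"
proof -
  have meas: "(\<lambda>x. indicator (cball 0 (real k)) x *\<^sub>R u x) \<in> borel_measurable lebesgue" for k
    using assms unfolding L_frac_def L1_loc_def
    by (auto simp: set_integrable_def dest!: spec[of _ "cball 0 (real k)"])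
  show ?thesis
  proof (rule borel_measurable_LIMSEQ_real[OF _ meas])
    fix x :: "(real, 'n) vec"
    obtain K where K: "norm x \<le> real K"
      using real_arch_simple by blast
    have "eventually (\<lambda>k. indicator (cball 0 (real k)) x *\<^sub>R u x = u x) sequentially"
      using eventually_ge_at_top[of K] by eventually_elim (use K in \<open>auto simp: indicator_def\<close>)
    then show "(\<lambda>k. indicator (cball 0 (real k)) x *\<^sub>R u x) \<longlonglongrightarrow> u x"
      by (rule tendsto_eventually)
  qed
qed

text \<open>
  Away from \<open>x\<close> the kernel centred at \<open>x\<close> is dominated by the weight \<open>1 / (1 + norm y powr p)\<close> that
  defines \<^const>\<open>L_frac\<close>, because \<open>1\<close> and \<open>norm y\<close> are both bounded by multiples of \<open>norm (x - y)\<close>.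
\<close>

lemma L_frac_kernel_integrable:
  fixes x :: "(real, 'n::finite) vec"
  assumes u: "u \<in> L_frac s" and "0 < s" and r: "0 < r"
  shows "integrable lebesgue (\<lambda>y. indicator (- ball x r) y * (\<bar>u y\<bar> * frac_kernel s (x - y)))"
proof -
  let ?p = "real CARD('n) + 2 * s"
  have p: "0 < ?p" using \<open>0 < s\<close> by (simp add: add_nonneg_pos)
  define M where "M = (1 / r) powr ?p + (norm x / r + 1) powr ?p"
  have M0: "0 \<le> M" by (simp add: M_def)
  have I: "integrable lebesgue (\<lambda>y. M * (\<bar>u y\<bar> / (1 + norm y powr ?p)))"
    using u unfolding L_frac_def by (intro integrable_mult_right) auto
  show ?thesis
  proof (rule Bochner_Integration.integrable_bound[OF I])
    show "(\<lambda>y. indicator (- ball x r) y * (\<bar>u y\<bar> * frac_kernel s (x - y))) \<in> borel_measurable lebesgue"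
      using L_frac_measurable[OF u] frac_kernel_shift_measurable
      by (intro borel_measurable_times borel_measurable_indicator borel_measurable_abs) auto
    show "AE y in lebesgue. norm (indicator (- ball x r) y * (\<bar>u y\<bar> * frac_kernel s (x - y)))
        \<le> norm (M * (\<bar>u y\<bar> / (1 + norm y powr ?p)))"
    proof (rule AE_I2)
      fix y
      show "norm (indicator (- ball x r) y * (\<bar>u y\<bar> * frac_kernel s (x - y)))
        \<le> norm (M * (\<bar>u y\<bar> / (1 + norm y powr ?p)))"
      proof (cases "y \<in> ball x r")
        case False
        define d where "d = norm (x - y)"
        have d: "r \<le> d" using False by (simp add: d_def dist_norm)
        have "norm y \<le> norm x + d"
          using norm_triangle_ineq4[of x "x - y"] by (simp add: d_def)
        also have "\<dots> \<le> (norm x / r + 1) * d"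
          using d r by (simp add: field_simps) (simp add: mult_right_mono mult.commute)
        finally have "norm y powr ?p \<le> ((norm x / r + 1) * d) powr ?p"
          using p by (intro powr_mono2) auto
        also have "\<dots> = (norm x / r + 1) powr ?p * d powr ?p"
          using d r by (simp add: powr_mult)
        finally have 1: "norm y powr ?p \<le> (norm x / r + 1) powr ?p * d powr ?p" .
        have "1 = 1 powr ?p" by simp
        also have "\<dots> \<le> (1 / r * d) powr ?p"
          using p d r by (intro powr_mono2) (auto simp: field_simps)
        also have "\<dots> = (1 / r) powr ?p * d powr ?p"
          using d r by (intro powr_mult)
        finally have "1 + norm y powr ?p \<le> M * d powr ?p"
          using 1 by (simp add: M_def algebra_simps)
        moreover have "0 < 1 + norm y powr ?p" by (simp add: add_pos_nonneg)
        moreover have "0 < d powr ?p" using d r by simp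
        ultimately have "1 / d powr ?p \<le> M / (1 + norm y powr ?p)"
          by (simp add: field_simps)
        then have "\<bar>u y\<bar> * (1 / d powr ?p) \<le> \<bar>u y\<bar> * (M / (1 + norm y powr ?p))"
          by (intro mult_left_mono) auto
        moreover have "frac_kernel s (x - y) = 1 / d powr ?p"
          unfolding d_def frac_kernel_def by (rule powr_minus_divide)
        ultimately show ?thesis
          using M0 False by (simp add: indicator_def abs_mult mult.commute)
      qed simp
    qed
  qed
qed

text \<open>
  The singular integrand with the linear term of the Taylor expansion removed on a ball. The removed
  part is odd about \<open>x\<close>, hence invisible to the principal value, and what remains is integrable
  when \<open>v\<close> is the gradient of \<open>u\<close> at \<open>x\<close>. Thus the principal value becomes an ordinary
  integral, to which reflections and pointwise comparison apply.
\<close>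

definition pv_integrand ::
    "real \<Rightarrow> ((real, 'n::finite) vec \<Rightarrow> real) \<Rightarrow> (real, 'n) vec \<Rightarrow> (real, 'n) vec \<Rightarrow> real \<Rightarrow> (real, 'n) vec \<Rightarrow> real" where
  "pv_integrand s u x v r y =
     (u x - u y + indicator (ball x r) y * (v \<bullet> (y - x))) * frac_kernel s (x - y)"

text \<open>
  Close to \<open>x\<close> the Taylor bound leaves the singularity \<open>norm (y - x) powr (2 - n - 2 * s)\<close>, integrable
  since \<open>s < 1\<close>; farther away the kernel has no singularity and the weight of \<^const>\<open>L_frac\<close>
  controls \<open>u\<close>. The cut-off radius \<open>r\<close> may exceed the radius \<open>\<rho>\<close> of the Taylor bound.
\<close>

lemma pv_integrand_integrable:
  fixes x :: "(real, 'n::finite) vec"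
  assumes s: "0 < s" "s < 1" and u: "u \<in> L_frac s" and r: "0 < r" and \<rho>: "0 < \<rho>"
    and taylor: "\<And>y. y \<in> cball x \<rho> \<Longrightarrow> \<bar>u y - u x - v \<bullet> (y - x)\<bar> \<le> L * (norm (y - x))\<^sup>2"
  shows "integrable lebesgue (pv_integrand s u x v r)"
proof -
  \<comment> \<open>\<open>r / 2\<close> keeps the closed ball of radius \<open>t\<close> inside the open ball of the cut-off.\<close>
  define t where "t = min \<rho> (r / 2)"
  have t: "0 < t" "t \<le> \<rho>" "t < r" using r \<rho> by (auto simp: t_def)
  have near: "integrable lebesgue (\<lambda>y. indicator (cball x t) y * ((norm (y - x))\<^sup>2 * frac_kernel s (x - y)))"
    using frac_kernel_near[OF s(2), where 'n = 'n] t(1) by auto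
  let ?c = "\<bar>u x\<bar> + norm v * r"
  let ?b = "\<lambda>y. L * (indicator (cball x t) y * ((norm (y - x))\<^sup>2 * frac_kernel s (x - y)))
     + (?c * (indicator (- ball x t) y * frac_kernel s (x - y)) + indicator (- ball x t) y * (\<bar>u y\<bar> * frac_kernel s (x - y)))"
  have I: "integrable lebesgue ?b"
    using near frac_kernel_tail_integrable[OF s(1) t(1)] L_frac_kernel_integrable[OF u s(1) t(1)]
    by (intro Bochner_Integration.integrable_add integrable_mult_right)
  show ?thesis
  proof (rule Bochner_Integration.integrable_bound[OF I])
    show "pv_integrand s u x v r \<in> borel_measurable lebesgue"
    proof -
      have "(\<lambda>y. indicator (ball x r) y * (v \<bullet> (y - x))) \<in> borel_measurable lebesgue"
        by (intro borel_measurable_times borel_measurable_indicator inner_shift_measurable) auto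
      then show ?thesis
        unfolding pv_integrand_def[abs_def]
        by (intro borel_measurable_times[OF _ frac_kernel_shift_measurable] borel_measurable_add
            borel_measurable_diff borel_measurable_const L_frac_measurable[OF u])
    qed
    show "AE y in lebesgue. norm (pv_integrand s u x v r y) \<le> norm (?b y)"
    proof (rule AE_I2)
      fix y
      let ?K = "frac_kernel s (x - y)"
      have L: "0 \<le> L * (norm (y - x))\<^sup>2" if "y \<in> cball x t"
        using taylor[of y] t that by force
      have "norm (pv_integrand s u x v r y) \<le> ?b y"
      proof (cases "y \<in> cball x t")
        case True
        then have "y \<in> ball x r" using t by auto
        then have "pv_integrand s u x v r y = - ((u y - u x - v \<bullet> (y - x)) * ?K)"
          by (simp add: pv_integrand_def left_diff_distrib distrib_right)
        then have "norm (pv_integrand s u x v r y) = \<bar>u y - u x - v \<bullet> (y - x)\<bar> * ?K"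
          by (simp add: abs_mult)
        also have "\<dots> \<le> L * (norm (y - x))\<^sup>2 * ?K"
          using True t by (intro mult_right_mono taylor) auto
        also have "\<dots> = L * (indicator (cball x t) y * ((norm (y - x))\<^sup>2 * ?K))"
          using True by simp
        also have "\<dots> \<le> ?b y"
          using r by (auto intro!: add_nonneg_nonneg mult_nonneg_nonneg)
        finally show ?thesis .
      next
        case False
        have "\<bar>indicator (ball x r) y * (v \<bullet> (y - x))\<bar> \<le> norm v * r"
        proof (cases "y \<in> ball x r")
          case True
          have "\<bar>v \<bullet> (y - x)\<bar> \<le> norm v * norm (y - x)" by (rule Cauchy_Schwarz_ineq2)
          also have "\<dots> \<le> norm v * r"
            using True by (intro mult_left_mono) (auto simp: dist_norm norm_minus_commute)
          finally show ?thesis using True by simp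
        qed (use r in simp)
        then have "\<bar>u x - u y + indicator (ball x r) y * (v \<bullet> (y - x))\<bar> \<le> ?c + \<bar>u y\<bar>"
          by linarith
        then have "norm (pv_integrand s u x v r y) \<le> (?c + \<bar>u y\<bar>) * ?K"
          unfolding pv_integrand_def by (simp add: abs_mult mult_right_mono)
        also have "\<dots> = ?b y"
          using False by (simp add: indicator_def algebra_simps)
        finally show ?thesis .
      qed
      then show "norm (pv_integrand s u x v r y) \<le> norm (?b y)" by simp
    qed
  qed
qed

text \<open>
  Outside any ball about \<open>x\<close> the linear term is integrable and odd under \<open>y \<mapsto> 2 *\<^sub>R x - y\<close>, so the
  truncated integrals agree with those of \<^const>\<open>pv_integrand\<close>, which converge by dominated
  convergence. In particular the limit in the definition of \<^const>\<open>frac_laplacian\<close> exists.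
\<close>

lemma frac_laplacian_eq_integral:
  fixes x :: "(real, 'n::{finite,one}) vec"
  assumes s: "0 < s" and u: "u \<in> L_frac s" and r: "0 < r"
    and F: "integrable lebesgue (pv_integrand s u x v r)"
  shows "frac_laplacian s u x = frac_laplacian_const TYPE('n) s * (LINT y|lebesgue. pv_integrand s u x v r y)"
proof -
  let ?F = "pv_integrand s u x v r"
  have cut: "(LINT y:(UNIV - ball x \<epsilon>)|lebesgue. (u x - u y) / norm (x - y) powr (real CARD('n) + 2 * s))
      = (LINT y|lebesgue. indicator (- ball x \<epsilon>) y * ?F y)" (is "?I = ?J") if \<epsilon>: "0 < \<epsilon>" for \<epsilon>
  proof -
    define odd_part where "odd_part = (\<lambda>y. indicator (- ball x \<epsilon>) y * (indicator (ball x r) y * (v \<bullet> (y - x))) * frac_kernel s (x - y))"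
    have int_odd: "integrable lebesgue odd_part"
    proof (rule Bochner_Integration.integrable_bound)
      show "integrable lebesgue (\<lambda>y. (norm v * r) * (indicator (- ball x \<epsilon>) y * frac_kernel s (x - y)))"
        using frac_kernel_tail_integrable[OF s \<epsilon>] by (rule integrable_mult_right)
      show "odd_part \<in> borel_measurable lebesgue"
        unfolding odd_part_def
        by (intro borel_measurable_times borel_measurable_indicator inner_shift_measurable
            frac_kernel_shift_measurable) auto
      show "AE y in lebesgue. norm (odd_part y) \<le> norm ((norm v * r) * (indicator (- ball x \<epsilon>) y * frac_kernel s (x - y)))"
      proof (rule AE_I2)
        fix y
        show "norm (odd_part y) \<le> norm ((norm v * r) * (indicator (- ball x \<epsilon>) y * frac_kernel s (x - y)))"
        proof (cases "y \<in> ball x r \<and> y \<notin> ball x \<epsilon>")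
          case True
          have "\<bar>v \<bullet> (y - x)\<bar> \<le> norm v * norm (y - x)" by (rule Cauchy_Schwarz_ineq2)
          also have "\<dots> \<le> norm v * r"
            using True by (intro mult_left_mono) (auto simp: dist_norm norm_minus_commute)
          finally show ?thesis using True r
            by (simp add: odd_part_def abs_mult mult_right_mono)
        qed (auto simp: odd_part_def indicator_def)
      qed
    qed
    have "odd_part (2 *\<^sub>R x - y) = - odd_part y" for y
    proof -
      have "2 *\<^sub>R x - y - x = x - y" "x - (2 *\<^sub>R x - y) = y - x"
        by (simp_all add: scaleR_2)
      moreover have "frac_kernel s (y - x) = frac_kernel s (x - y)"
        by (simp add: frac_kernel_def norm_minus_commute)
      moreover have "dist x (2 *\<^sub>R x - y) = dist x y"
        by (simp add: dist_norm scaleR_2 norm_minus_commute[of x y])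
      moreover have "v \<bullet> (x - y) = - (v \<bullet> (y - x))"
        by (simp add: inner_diff_right)
      ultimately show ?thesis
        by (simp add: odd_part_def indicator_def)
    qed
    then have odd0: "(LINT y|lebesgue. odd_part y) = 0"
      using integral_measure_preserving(2)[OF lebesgue_point_reflection[of "2 *\<^sub>R x"] int_odd] by simp
    have int_F: "integrable lebesgue (\<lambda>y. indicator (- ball x \<epsilon>) y * ?F y)"
      using integrable_mult_indicator[OF _ F, of "- ball x \<epsilon>"] by simp
    have "?I = (LINT y|lebesgue. indicator (- ball x \<epsilon>) y * ?F y - odd_part y)"
      unfolding set_lebesgue_integral_def divide_eq_frac_kernel
      by (intro Bochner_Integration.integral_cong)
         (auto simp: odd_part_def pv_integrand_def indicator_def algebra_simps)
    also have "\<dots> = ?J"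
      using Bochner_Integration.integral_diff[OF int_F int_odd] odd0 by simp
    finally show ?thesis .
  qed
  have "((\<lambda>\<epsilon>. LINT y:(UNIV - ball x \<epsilon>)|lebesgue. (u x - u y) / norm (x - y) powr (real CARD('n) + 2 * s))
      \<longlongrightarrow> (LINT y|lebesgue. ?F y)) (at_right 0)"
  proof (rule tendsto_at_right_sequentially[of 0 1])
    fix S :: "nat \<Rightarrow> real"
    assume S: "\<And>n. 0 < S n" "S \<longlonglongrightarrow> 0"
    have "(\<lambda>n. LINT y|lebesgue. indicator (- ball x (S n)) y * ?F y) \<longlonglongrightarrow> (LINT y|lebesgue. ?F y)"
    proof (rule integral_dominated_convergence)
      show "integrable lebesgue (\<lambda>y. norm (?F y))" using F by simp
      show "?F \<in> borel_measurable lebesgue" using F by simp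
      show "(\<lambda>y. indicator (- ball x (S n)) y * ?F y) \<in> borel_measurable lebesgue" for n
        using F by (intro borel_measurable_times borel_measurable_indicator) auto
      show "AE y in lebesgue. norm (indicator (- ball x (S n)) y * ?F y) \<le> norm (?F y)" for n
        by (rule AE_I2) (simp add: indicator_def)
      show "AE y in lebesgue. (\<lambda>n. indicator (- ball x (S n)) y * ?F y) \<longlonglongrightarrow> ?F y"
      proof (rule AE_I2)
        fix y
        show "(\<lambda>n. indicator (- ball x (S n)) y * ?F y) \<longlonglongrightarrow> ?F y"
        proof (cases "y = x")
          case True
          then show ?thesis by (simp add: pv_integrand_def)
        next
          case False
          then have "eventually (\<lambda>n. S n < dist x y) sequentially"
            using S(2) by (intro order_tendstoD(2)) auto
          then have "eventually (\<lambda>n. indicator (- ball x (S n)) y * ?F y = ?F y) sequentially"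
            by eventually_elim (simp add: indicator_def)
          then show ?thesis by (rule tendsto_eventually)
        qed
      qed
    qed
    then show "(\<lambda>n. LINT y:(UNIV - ball x (S n))|lebesgue. (u x - u y) / norm (x - y) powr (real CARD('n) + 2 * s))
      \<longlonglongrightarrow> (LINT y|lebesgue. ?F y)"
      unfolding cut[OF S(1)] .
  qed simp
  then show ?thesis
    unfolding frac_laplacian_def by (subst tendsto_Lim) auto
qed

lemma open_AE_witness:
  fixes U :: "'a::euclidean_space set"
  assumes "open U" "U \<noteq> {}" "AE y in lebesgue. P y"
  obtains y where "y \<in> U" "P y"
proof -
  obtain N where N: "{y. \<not> P y} \<subseteq> N" "N \<in> null_sets lebesgue"
    using assms(3) by (auto elim!: AE_E simp: null_sets_def)
  have "\<not> U \<subseteq> N"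
  proof
    assume "U \<subseteq> N"
    then have "negligible U"
      using N(2) negligible_iff_null_sets negligible_subset by blast
    then show False
      using open_not_negligible assms by blast
  qed
  then show thesis using that N(1) by blast
qed

text \<open>
  A divergent integral has the value \<open>0\<close>, and so has the inverse of \<open>0\<close>; the constant would then
  annihilate the operator
  unless the defining integral converges and does not vanish. It converges by
  \<open>1 - cos t \<le> t\<^sup>2 / 2\<close> near the origin and \<open>1 - cos t \<le> 2\<close> far away; it is positive because the
  cosine is below \<open>1\<close> on the slab \<open>0 < \<zeta> $ 1 < 1\<close>.
\<close>

lemma frac_laplacian_const_pos:
  fixes s :: real
  assumes s: "0 < s" "s < 1"
  shows "0 < frac_laplacian_const TYPE('n::{finite,one}) s"
proof -
  let ?f = "\<lambda>\<zeta> :: (real, 'n) vec. (1 - cos (2 * pi * \<zeta> $ 1)) * frac_kernel s \<zeta>"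
  have K: "frac_kernel s (- \<zeta>) = frac_kernel s \<zeta>" for \<zeta> :: "(real, 'n) vec"
    by (simp add: frac_kernel_def)
  have near: "integrable lebesgue (\<lambda>y :: (real, 'n) vec. indicator (cball 0 1) y * ((norm y)\<^sup>2 * frac_kernel s y))"
  proof -
    have "integrable lebesgue (\<lambda>y :: (real, 'n) vec. indicator (cball 0 1) y * ((norm (y - 0))\<^sup>2 * frac_kernel s (0 - y)))"
      using frac_kernel_near[OF s(2), where 'n = 'n]
      by (elim exE conjE) (drule spec[of _ 0], drule spec[of _ 1], simp)
    then show ?thesis by (simp add: K)
  qed
  have tail: "integrable lebesgue (\<lambda>y :: (real, 'n) vec. indicator (- ball 0 1) y * frac_kernel s y)"
    using frac_kernel_tail_integrable[OF s(1), of 1 "0 :: (real, 'n) vec"] by (simp add: K)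
  have cos_bound: "1 - cos t \<le> t\<^sup>2 / 2" for t :: real
  proof -
    have "(sin (t / 2))\<^sup>2 \<le> (t / 2)\<^sup>2"
      using abs_sin_x_le_abs_x[of "t / 2"] by (simp only: abs_le_square_iff)
    then show ?thesis
      using cos_double_sin[of "t / 2"] by (simp add: power_divide)
  qed
  have int: "integrable lebesgue ?f"
  proof (rule Bochner_Integration.integrable_bound)
    show "integrable lebesgue (\<lambda>y :: (real, 'n) vec. 2 * pi\<^sup>2 * (indicator (cball 0 1) y * ((norm y)\<^sup>2 * frac_kernel s y)) + 2 * (indicator (- ball 0 1) y * frac_kernel s y))"
      using near tail by (intro Bochner_Integration.integrable_add integrable_mult_right)
    show "?f \<in> borel_measurable lebesgue"
      by (rule measurable_completion) measurable
    show "AE y in lebesgue. norm (?f y) \<le> norm (2 * pi\<^sup>2 * (indicator (cball 0 1) y * ((norm y)\<^sup>2 * frac_kernel s y)) + 2 * (indicator (- ball 0 1) y * frac_kernel s y))"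
    proof (rule AE_I2)
      fix y :: "(real, 'n) vec"
      have 1: "1 - cos (2 * pi * y $ 1) \<le> 2 * pi\<^sup>2 * (norm y)\<^sup>2"
      proof -
        have "1 - cos (2 * pi * y $ 1) \<le> 2 * pi\<^sup>2 * (y $ 1)\<^sup>2"
          using cos_bound[of "2 * pi * y $ 1"] by (simp add: power_mult_distrib)
        also have "\<dots> \<le> 2 * pi\<^sup>2 * (norm y)\<^sup>2"
          using component_le_norm_cart[of y 1] by (intro mult_left_mono) (auto simp: abs_le_square_iff[symmetric])
        finally show ?thesis .
      qed
      have 2: "1 - cos (2 * pi * y $ 1) \<le> 2"
        using cos_ge_minus_one[of "2 * pi * y $ 1"] by linarith
      have 0: "0 \<le> 1 - cos (2 * pi * y $ 1)"
        using cos_le_one[of "2 * pi * y $ 1"] by linarith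
      have "norm (?f y) = (1 - cos (2 * pi * y $ 1)) * frac_kernel s y"
        using 0 by simp
      also have "\<dots> \<le> 2 * pi\<^sup>2 * (indicator (cball 0 1) y * ((norm y)\<^sup>2 * frac_kernel s y)) + 2 * (indicator (- ball 0 1) y * frac_kernel s y)"
      proof (cases "y \<in> cball 0 1")
        case True
        have "(1 - cos (2 * pi * y $ 1)) * frac_kernel s y \<le> (2 * pi\<^sup>2 * (norm y)\<^sup>2) * frac_kernel s y"
          using 1 by (rule mult_right_mono) simp
        then show ?thesis using True by (simp add: mult.assoc add_increasing2)
      next
        case False
        have "(1 - cos (2 * pi * y $ 1)) * frac_kernel s y \<le> 2 * frac_kernel s y"
          using 2 by (rule mult_right_mono) simp
        then show ?thesis using False by (simp add: indicator_def)
      qed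
      finally show "norm (?f y) \<le> norm (2 * pi\<^sup>2 * (indicator (cball 0 1) y * ((norm y)\<^sup>2 * frac_kernel s y)) + 2 * (indicator (- ball 0 1) y * frac_kernel s y))"
        by simp
    qed
  qed
  have nonneg: "0 \<le> ?f y" for y
    using cos_le_one[of "2 * pi * y $ 1"] by simp
  have "(LINT \<zeta>|lebesgue. ?f \<zeta>) \<noteq> 0"
  proof
    assume "(LINT \<zeta>|lebesgue. ?f \<zeta>) = 0"
    then have ae: "AE y in lebesgue. ?f y = 0"
      using integral_nonneg_eq_0_iff_AE[OF int] nonneg by simp
    let ?U = "{y :: (real, 'n) vec. 0 < y $ 1 \<and> y $ 1 < 1}"
    have U: "open ?U"
      by (intro open_Collect_conj open_Collect_less continuous_intros)
    have "(\<chi> i. 1 / 2) \<in> ?U" by simp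
    then have ne: "?U \<noteq> {}" by blast
    obtain y where y: "y \<in> ?U" "?f y = 0"
      by (rule open_AE_witness[OF U ne ae])
    have "0 < frac_kernel s y"
      using y(1) unfolding frac_kernel_def by auto
    with y(2) have "cos (2 * pi * y $ 1) = 1" by simp
    then obtain k :: int where "2 * pi * y $ 1 = of_int k * 2 * pi"
      using cos_one_2pi_int by metis
    then have "y $ 1 = of_int k" by simp
    with y(1) show False by auto
  qed
  moreover have "0 \<le> (LINT \<zeta>|lebesgue. ?f \<zeta>)"
    using nonneg by simp
  ultimately have "0 < (LINT \<zeta>|lebesgue. ?f \<zeta>)"
    by linarith
  then show ?thesis
    unfolding frac_laplacian_const_def divide_eq_frac_kernel by simp
qed

section \<open>Touching paraboloids, semicontinuity and growth\<close>

text \<open>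
  The mean value inequality, applied to \<open>u\<close> minus its linear part on the ball of radius
  \<open>norm (y - x)\<close>, where the gradient varies by at most \<open>L * norm (y - x)\<close>.
\<close>

lemma C11_loc_taylor:
  fixes u :: "'a::euclidean_space \<Rightarrow> real"
  assumes u: "u \<in> C11_loc \<Omega>" and \<Omega>: "open \<Omega>" and x: "x \<in> \<Omega>"
  obtains v \<rho> L where "GDERIV u x :> v" "0 < \<rho>"
    "\<forall>y\<in>cball x \<rho>. \<bar>u y - u x - v \<bullet> (y - x)\<bar> \<le> L * (norm (y - x))\<^sup>2"
proof -
  obtain g where g: "\<And>z. z \<in> \<Omega> \<Longrightarrow> GDERIV u z :> g z"
    and lip: "\<And>K. compact K \<Longrightarrow> K \<subseteq> \<Omega> \<Longrightarrow> \<exists>L. L-lipschitz_on K g"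
    using u unfolding C11_loc_def by blast
  obtain \<rho> where \<rho>: "0 < \<rho>" "cball x \<rho> \<subseteq> \<Omega>"
    using \<Omega> x open_contains_cball by blast
  obtain L where L: "L-lipschitz_on (cball x \<rho>) g"
    using lip[OF compact_cball \<rho>(2)] by blast
  have "\<bar>u y - u x - g x \<bullet> (y - x)\<bar> \<le> L * (norm (y - x))\<^sup>2" if y: "y \<in> cball x \<rho>" for y
  proof -
    let ?S = "cball x (norm (y - x))"
    have S: "?S \<subseteq> cball x \<rho>"
      using y by (auto simp: dist_norm norm_minus_commute)
    have L0: "0 \<le> L" using L by (rule lipschitz_on_nonneg)
    have "norm ((u y - y \<bullet> g x) - (u x - x \<bullet> g x)) \<le> (L * norm (y - x)) * norm (y - x)"
    proof (rule differentiable_bound[where S = ?S and f' = "\<lambda>z h. h \<bullet> g z - h \<bullet> g x"])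
      fix z assume z: "z \<in> ?S"
      then have zS: "z \<in> cball x \<rho>" using S by blast
      have "(u has_derivative (\<lambda>h. h \<bullet> g z)) (at z within ?S)"
        using g[of z] zS \<rho>(2) unfolding gderiv_def by (blast intro: has_derivative_at_withinI)
      then show "((\<lambda>z. u z - z \<bullet> g x) has_derivative (\<lambda>h. h \<bullet> g z - h \<bullet> g x)) (at z within ?S)"
        by (auto intro!: derivative_eq_intros)
      have "norm (g z - g x) \<le> L * dist z x"
        using lipschitz_onD[OF L zS, of x] \<rho>(1) by (simp add: dist_norm)
      also have "\<dots> \<le> L * norm (y - x)"
        using z L0 by (intro mult_left_mono) (auto simp: dist_commute)
      finally have le: "norm (g z - g x) \<le> L * norm (y - x)" .
      show "onorm (\<lambda>h. h \<bullet> g z - h \<bullet> g x) \<le> L * norm (y - x)"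
      proof (rule onorm_le)
        fix h
        have "norm (h \<bullet> g z - h \<bullet> g x) = \<bar>h \<bullet> (g z - g x)\<bar>"
          by (simp add: inner_diff_right)
        also have "\<dots> \<le> norm h * norm (g z - g x)"
          by (rule Cauchy_Schwarz_ineq2)
        also have "\<dots> \<le> (L * norm (y - x)) * norm h"
          using mult_right_mono[OF le norm_ge_zero[of h]] by (simp add: mult.commute)
        finally show "norm (h \<bullet> g z - h \<bullet> g x) \<le> (L * norm (y - x)) * norm h" .
      qed
    qed (auto simp: dist_norm norm_minus_commute)
    then show ?thesis
      by (simp add: power2_eq_square inner_diff_right inner_commute algebra_simps)
  qed
  then show thesis
    using that[of "g x" \<rho> L] g[OF x] \<rho>(1) by blast
qed

text \<open>
  \<open>u\<close> minus the paraboloid has a local minimum at \<open>x\<close>.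
\<close>

lemma GDERIV_touching_below:
  fixes u :: "'a::euclidean_space \<Rightarrow> real"
  assumes u: "GDERIV u x :> g" and r: "0 < r"
    and touch: "\<And>y. y \<in> ball x r \<Longrightarrow> u x + v \<bullet> (y - x) - A * (norm (y - x))\<^sup>2 \<le> u y"
  shows "g = v"
proof -
  let ?f = "\<lambda>y. u y - (y - x) \<bullet> v + A * ((y - x) \<bullet> (y - x))"
  have "(?f has_derivative (\<lambda>h. h \<bullet> g - h \<bullet> v)) (at x)"
    using u unfolding gderiv_def by (auto intro!: derivative_eq_intros)
  moreover have "\<forall>y\<in>ball x r. ?f x \<le> ?f y"
    using touch by (auto simp: power2_norm_eq_inner inner_commute algebra_simps)
  ultimately have "(\<lambda>h. h \<bullet> g - h \<bullet> v) = (\<lambda>h. 0)"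
    using r by (intro differential_zero_maxmin[of x "ball x r"]) auto
  from fun_cong[OF this, of "g - v"] have "(g - v) \<bullet> (g - v) = 0"
    by (simp add: inner_diff_right)
  then show ?thesis by simp
qed

lemma lower_semicontinuous_on_subset:
  assumes "lower_semicontinuous_on S f" "T \<subseteq> S"
  shows "lower_semicontinuous_on T f"
  using assms unfolding lower_semicontinuous_on_def
  by (meson at_le filter_leD subsetD)

lemma lower_semicontinuous_on_add:
  fixes f g :: "'a::topological_space \<Rightarrow> real"
  assumes f: "lower_semicontinuous_on S f" and g: "continuous_on S g"
  shows "lower_semicontinuous_on S (\<lambda>x. f x + g x)"
  unfolding lower_semicontinuous_on_def
proof (intro ballI allI impI)
  fix x a assume x: "x \<in> S" and a: "a < f x + g x"
  define d where "d = (f x + g x - a) / 2"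
  have d: "0 < d" using a by (simp add: d_def)
  have "eventually (\<lambda>y. f x - d < f y) (at x within S)"
    using f x d unfolding lower_semicontinuous_on_def by auto
  moreover have "eventually (\<lambda>y. g x - d < g y) (at x within S)"
    using g x d by (intro order_tendstoD(1)[of g "g x"]) (auto simp: continuous_on_def)
  ultimately show "eventually (\<lambda>y. a < f y + g y) (at x within S)"
  proof eventually_elim
    case (elim y)
    have "a = (f x - d) + (g x - d)"
      by (simp add: d_def field_simps)
    then show ?case using elim by linarith
  qed
qed

text \<open>
  If no minimum existed, every \<open>x\<close> would have a point \<open>p x\<close> of smaller value, and \<open>f > f (p x)\<close>
  near \<open>x\<close>. Among the finitely many points of a subcover choose \<open>z\<close> with \<open>f (p z)\<close> least: the
  neighbourhood containing \<open>p z\<close> contradicts that choice.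
\<close>

lemma lower_semicontinuous_on_attains_min:
  fixes f :: "'a::topological_space \<Rightarrow> real"
  assumes K: "compact K" "K \<noteq> {}" and f: "lower_semicontinuous_on K f"
  obtains x where "x \<in> K" "\<forall>y\<in>K. f x \<le> f y"
proof (rule ccontr)
  assume "\<not> thesis"
  then have "\<forall>x\<in>K. \<exists>y\<in>K. f y < f x"
    using that by (meson not_less)
  then obtain p where p: "\<And>x. x \<in> K \<Longrightarrow> p x \<in> K" "\<And>x. x \<in> K \<Longrightarrow> f (p x) < f x"
    by metis
  have "\<exists>U. open U \<and> x \<in> U \<and> (\<forall>y\<in>U \<inter> K. f (p x) < f y)" if x: "x \<in> K" for x
  proof -
    have "eventually (\<lambda>y. f (p x) < f y) (at x within K)"
      using f x p(2)[OF x] unfolding lower_semicontinuous_on_def by blast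
    then obtain U where U: "open U" "x \<in> U" "\<forall>y\<in>U. y \<noteq> x \<longrightarrow> y \<in> K \<longrightarrow> f (p x) < f y"
      unfolding eventually_at_topological by blast
    have "f (p x) < f y" if "y \<in> U \<inter> K" for y
      using U(3) p(2)[OF x] that by (cases "y = x") auto
    with U(1,2) show ?thesis by blast
  qed
  then obtain U where U: "\<And>x. x \<in> K \<Longrightarrow> open (U x)" "\<And>x. x \<in> K \<Longrightarrow> x \<in> U x"
    "\<And>x y. x \<in> K \<Longrightarrow> y \<in> U x \<inter> K \<Longrightarrow> f (p x) < f y"
    by metis
  have "K \<subseteq> (\<Union>x\<in>K. U x)" using U(2) by blast
  then obtain C where C: "C \<subseteq> K" "finite C" "K \<subseteq> (\<Union>x\<in>C. U x)"
    using compactE_image[OF K(1), of K U] U(1) by blast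
  have "C \<noteq> {}" using C(3) K(2) by blast
  then have "Min ((\<lambda>x. f (p x)) ` C) \<in> (\<lambda>x. f (p x)) ` C"
    using C(2) by (intro Min_in) auto
  then obtain z where z: "z \<in> C" "f (p z) = Min ((\<lambda>x. f (p x)) ` C)"
    by force
  have "p z \<in> K" using z(1) C(1) p(1) by blast
  then obtain z' where z': "z' \<in> C" "p z \<in> U z'"
    using C(3) by blast
  have "f (p z') < f (p z)"
    using U(3)[of z' "p z"] z' C(1) \<open>p z \<in> K\<close> by blast
  moreover have "f (p z) \<le> f (p z')"
    unfolding z(2) using C(2) z'(1) by simp
  ultimately show False by simp
qed

text \<open>
  The weight \<open>M + norm x powr \<gamma>\<close> is almost constant on bounded scales once \<open>M\<close> is large: the error is
  a factor \<open>1 + \<epsilon>\<close> and a term whose coefficient \<open>\<delta>\<close> is as small as desired. Only \<open>M\<close> depends on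
  \<open>\<gamma>\<close> and \<open>\<delta>\<close>, which is what lets the width of the region be chosen before \<open>\<gamma>\<close>. If
  \<open>norm (y - x)\<close> is small compared with \<open>norm x\<close>, the power grows by a factor \<open>1 + \<epsilon>\<close> only;
  otherwise \<open>norm y powr \<gamma>\<close> is at most a multiple of \<open>norm (y - x) powr \<gamma>\<close>, absorbed by \<open>M * \<delta>\<close>.
\<close>

lemma power_weight_growth:
  fixes \<gamma> \<epsilon> \<delta> :: real
  assumes \<gamma>: "0 < \<gamma>" "\<gamma> < 2" and \<epsilon>: "0 < \<epsilon>" "\<epsilon> \<le> 1" and \<delta>: "0 < \<delta>"
  shows "\<exists>M\<ge>1. \<forall>x y :: 'a::real_normed_vector.
    M + norm y powr \<gamma> \<le> (M + norm x powr \<gamma>) * (1 + \<epsilon> + \<delta> * norm (y - x) powr \<gamma>)"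
proof -
  \<comment> \<open>Chosen so that \<open>(1 + \<theta>)\<^sup>2 \<le> 1 + \<epsilon>\<close>.\<close>
  define \<theta> where "\<theta> = \<epsilon> / 3"
  have \<theta>: "0 < \<theta>" using \<epsilon> by (simp add: \<theta>_def)
  define D where "D = (1 + 1 / \<theta>)\<^sup>2"
  have le_sq: "t powr \<gamma> \<le> t\<^sup>2" if "1 \<le> t" for t :: real
  proof -
    have "t powr \<gamma> \<le> t powr 2" using that \<gamma> by (intro powr_mono) auto
    then show ?thesis using that by simp
  qed
  define M where "M = max 1 (D / \<delta>)"
  have M: "1 \<le> M" "D \<le> M * \<delta>"
    using \<delta> by (auto simp: M_def pos_divide_le_eq[symmetric])
  show ?thesis
  proof (intro exI[of _ M] conjI M(1) allI)
    fix x y :: 'a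
    let ?a = "norm x" and ?b = "norm (y - x)"
    have y: "norm y \<le> ?a + ?b"
      using norm_triangle_ineq[of x "y - x"] by simp
    have "norm y powr \<gamma> \<le> (1 + \<epsilon>) * ?a powr \<gamma> + M * \<delta> * ?b powr \<gamma>"
    proof (cases "?b \<le> \<theta> * ?a")
      case True
      then have "norm y \<le> (1 + \<theta>) * ?a" using y by (simp add: algebra_simps)
      then have "norm y powr \<gamma> \<le> ((1 + \<theta>) * ?a) powr \<gamma>"
        using \<gamma> by (intro powr_mono2) auto
      also have "\<dots> = (1 + \<theta>) powr \<gamma> * ?a powr \<gamma>"
        using \<theta> by (intro powr_mult)
      also have "\<dots> \<le> (1 + \<theta>)\<^sup>2 * ?a powr \<gamma>"
        using \<theta> by (intro mult_right_mono le_sq) auto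
      also have "\<dots> \<le> (1 + \<epsilon>) * ?a powr \<gamma>"
      proof (rule mult_right_mono)
        have "\<epsilon> * \<epsilon> \<le> \<epsilon>" using \<epsilon> by (simp add: mult_left_le)
        moreover have "(1 + \<theta>)\<^sup>2 = 1 + 2 * \<epsilon> / 3 + \<epsilon> * \<epsilon> / 9"
          by (simp add: \<theta>_def power2_eq_square field_simps)
        ultimately show "(1 + \<theta>)\<^sup>2 \<le> 1 + \<epsilon>"
          using \<epsilon> by linarith
      qed simp
      also have "\<dots> \<le> (1 + \<epsilon>) * ?a powr \<gamma> + M * \<delta> * ?b powr \<gamma>"
        using M \<delta> by simp
      finally show ?thesis .
    next
      case False
      then have "?a \<le> ?b / \<theta>" using \<theta> by (simp add: field_simps)
      then have "norm y \<le> (1 + 1 / \<theta>) * ?b" using y by (simp add: algebra_simps)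
      then have "norm y powr \<gamma> \<le> ((1 + 1 / \<theta>) * ?b) powr \<gamma>"
        using \<gamma> by (intro powr_mono2) auto
      also have "\<dots> = (1 + 1 / \<theta>) powr \<gamma> * ?b powr \<gamma>"
        using \<theta> by (intro powr_mult)
      also have "\<dots> \<le> D * ?b powr \<gamma>"
        unfolding D_def using \<theta> by (intro mult_right_mono le_sq) auto
      also have "\<dots> \<le> M * \<delta> * ?b powr \<gamma>"
        using M(2) by (intro mult_right_mono) auto
      also have "\<dots> \<le> (1 + \<epsilon>) * ?a powr \<gamma> + M * \<delta> * ?b powr \<gamma>"
        using \<epsilon> by simp
      finally show ?thesis .
    qed
    moreover have "0 \<le> M * \<epsilon> + ?a powr \<gamma> * (\<delta> * ?b powr \<gamma>)"
      using M \<epsilon> \<delta> by simp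
    ultimately show "M + norm y powr \<gamma> \<le> (M + ?a powr \<gamma>) * (1 + \<epsilon> + \<delta> * ?b powr \<gamma>)"
      by (simp add: algebra_simps)
  qed
qed

section \<open>Reflection and the kernel\<close>

lemma reflect_nth_one: "reflect lam y $ 1 = 2 * lam - y $ 1"
  by (simp add: reflect_def)

lemma reflect_reflect [simp]: "reflect lam (reflect lam y) = y"
  by (simp add: reflect_def vec_eq_iff)

lemma reflect_eq_translate: "reflect lam y = y + (2 * (lam - y $ 1)) *\<^sub>R axis 1 1"
  by (simp add: reflect_def vec_eq_iff axis_def)

lemma norm_diff_reflect:
  "(norm (x - reflect lam y))\<^sup>2 = (norm (x - y))\<^sup>2 + 4 * (lam - x $ 1) * (lam - y $ 1)"
proof -
  have "x - reflect lam y = (x - y) - (2 * (lam - y $ 1)) *\<^sub>R axis 1 1"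
    by (simp add: reflect_eq_translate)
  moreover have "(norm (a - b))\<^sup>2 = (norm a)\<^sup>2 - 2 * (a \<bullet> b) + (norm b)\<^sup>2" for a b :: "(real, 'a) vec"
    by (simp add: power2_norm_eq_inner inner_diff_left inner_diff_right inner_commute)
  ultimately have "(norm (x - reflect lam y))\<^sup>2
      = (norm (x - y))\<^sup>2 - 2 * ((x - y) \<bullet> ((2 * (lam - y $ 1)) *\<^sub>R axis 1 1))
        + (norm ((2 * (lam - y $ 1)) *\<^sub>R (axis 1 1 :: (real, 'a) vec)))\<^sup>2"
    by metis
  moreover have "(norm (k *\<^sub>R (axis 1 1 :: (real, 'a) vec)))\<^sup>2 = k\<^sup>2" for k :: real
    by (simp add: norm_axis_1)
  moreover have "(x - y) \<bullet> (k *\<^sub>R axis 1 1) = k * (x $ 1 - y $ 1)" for k :: real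
    by (simp add: inner_axis)
  ultimately show ?thesis
    by (simp only:) (simp add: power2_eq_square algebra_simps)
qed

lemma norm_reflect_le: "norm (reflect lam y) \<le> norm y + 2 * \<bar>lam\<bar>"
proof (rule power2_le_imp_le)
  have "\<bar>lam * y $ 1\<bar> \<le> \<bar>lam\<bar> * norm y"
    unfolding abs_mult by (intro mult_left_mono component_le_norm_cart) simp
  then have "4 * lam * (lam - y $ 1) \<le> 4 * (\<bar>lam\<bar> * norm y) + 4 * lam\<^sup>2"
    by (simp add: algebra_simps power2_eq_square abs_le_iff)
  moreover have "\<bar>lam\<bar>\<^sup>2 = lam\<^sup>2" by simp
  ultimately show "(norm (reflect lam y))\<^sup>2 \<le> (norm y + 2 * \<bar>lam\<bar>)\<^sup>2"
    using norm_diff_reflect[of 0 lam y] by (simp add: power2_sum power_mult_distrib algebra_simps)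
qed simp

lemma frac_kernel_reflect_less:
  assumes "0 < s" "x $ 1 < lam" "y $ 1 < lam" "y \<noteq> x"
  shows "frac_kernel s (x - reflect lam y) < frac_kernel s (x - y)"
proof -
  have "(norm (x - y))\<^sup>2 < (norm (x - reflect lam y))\<^sup>2"
    unfolding norm_diff_reflect using assms by simp
  then have "norm (x - y) < norm (x - reflect lam y)"
    by (rule power2_less_imp_less) simp
  then show ?thesis
    unfolding frac_kernel_def using assms by (intro powr_less_mono2_neg) auto
qed

text \<open>
  The two exceptional sets, the hyperplane of reflection and the orbit of \<open>x\<close>, are null. The point
  \<open>x\<close> has to be excluded because \<^const>\<open>frac_kernel\<close> vanishes at the origin, where the
  inequality between a kernel and its reflection fails.
\<close>

lemma AE_reflection_symmetric:
  fixes x :: "(real, 'n::{finite,one}) vec"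
  assumes P: "\<And>y. y $ 1 < lam \<Longrightarrow> y \<noteq> x \<Longrightarrow> P y"
    and sym: "\<And>y. P (reflect lam y) \<Longrightarrow> P y"
  shows "AE y in lebesgue. P y"
proof -
  let ?N = "{y :: (real, 'n) vec. axis 1 1 \<bullet> y = lam} \<union> {x, reflect lam x}"
  have "negligible ?N"
    by (intro negligible_Un negligible_hyperplane negligible_finite disjI1) auto
  then have "AE y in lebesgue. y \<notin> ?N"
    by (intro AE_not_in) (simp add: negligible_iff_null_sets)
  then show ?thesis
  proof eventually_elim
    case (elim y)
    then have y: "y $ 1 \<noteq> lam" "y \<noteq> x" "reflect lam y \<noteq> x"
      by (auto simp: inner_axis')
    show ?case
    proof (cases "y $ 1 < lam")
      case True
      with y P show ?thesis by blast
    next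
      case False
      then have "reflect lam y $ 1 < lam" using y by (simp add: reflect_nth_one)
      with y P sym show ?thesis by blast
    qed
  qed
qed

lemma integral_reflect:
  fixes F :: "(real, 'n::{finite,one}) vec \<Rightarrow> real"
  assumes F: "integrable lebesgue F"
  shows "integrable lebesgue (\<lambda>y. F y + F (reflect lam y))"
    and "(LINT y|lebesgue. F y + F (reflect lam y)) = 2 * (LINT y|lebesgue. F y)"
proof -
  note mp = integral_measure_preserving[OF lebesgue_reflect[of lam] F]
  show "integrable lebesgue (\<lambda>y. F y + F (reflect lam y))"
    using F mp(1) by (rule Bochner_Integration.integrable_add)
  show "(LINT y|lebesgue. F y + F (reflect lam y)) = 2 * (LINT y|lebesgue. F y)"
    using Bochner_Integration.integral_add[OF F mp(1)] mp(2) by simp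
qed

text \<open>
  Folding the whole space onto the half space: an antisymmetric function is compared through the
  sums of its values at \<open>y\<close> and at the reflected point, where the two kernels combine.
\<close>

lemma integral_mono_reflect:
  fixes F B :: "(real, 'n::{finite,one}) vec \<Rightarrow> real"
  assumes F: "integrable lebesgue F" and B: "integrable lebesgue B"
    and le: "\<And>y. y $ 1 < lam \<Longrightarrow> y \<noteq> x \<Longrightarrow> F y + F (reflect lam y) \<le> B y + B (reflect lam y)"
  shows "(LINT y|lebesgue. F y) \<le> (LINT y|lebesgue. B y)"
proof -
  have "AE y in lebesgue. F y + F (reflect lam y) \<le> B y + B (reflect lam y)"
    by (rule AE_reflection_symmetric[of lam x]) (use le in \<open>auto simp: add.commute\<close>)
  then have "(LINT y|lebesgue. F y + F (reflect lam y)) \<le> (LINT y|lebesgue. B y + B (reflect lam y))"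
    by (rule integral_mono_AE[OF integral_reflect(1)[OF F] integral_reflect(1)[OF B]])
  then show ?thesis
    by (simp add: integral_reflect(2)[OF F] integral_reflect(2)[OF B])
qed

text \<open>
  Beyond the hyperplane there is a ball of radius \<open>5 * r\<close> at distance at most \<open>15 * r\<close> from \<open>x\<close>. This
  mass, which blows up as \<open>x\<close> approaches the hyperplane, is the gain from the antisymmetry.
\<close>

lemma frac_kernel_mass_beyond:
  fixes s :: real
  assumes s: "0 < s"
  shows "\<exists>c>0. \<forall>(x :: (real, 'n::{finite,one}) vec) lam r. 0 < r \<longrightarrow> x $ 1 < lam \<longrightarrow> lam - x $ 1 \<le> 5 * r \<longrightarrow>
    integrable lebesgue (\<lambda>y. indicator {y. lam \<le> y $ 1} y * frac_kernel s (x - y)) \<and>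
    c * r powr - (2 * s) \<le> (LINT y|lebesgue. indicator {y. lam \<le> y $ 1} y * frac_kernel s (x - y))"
proof -
  let ?n = "real CARD('n)"
  define c where "c = 15 powr - (?n + 2 * s) * (unit_ball_vol ?n * 5 ^ CARD('n))"
  have c: "0 < c" by (simp add: c_def)
  show ?thesis
  proof (intro exI[of _ c] conjI c allI impI)
    fix x :: "(real, 'n) vec" and lam r :: real
    assume r: "0 < r" and x: "x $ 1 < lam" and d: "lam - x $ 1 \<le> 5 * r"
    let ?H = "{y :: (real, 'n) vec. lam \<le> y $ 1}"
    have H: "?H \<in> sets lebesgue"
    proof (rule sets_completionI_sets)
      have "closed ?H" by (intro closed_Collect_le continuous_intros)
      then show "?H \<in> sets lborel" by (simp add: borel_closed)
    qed
    have sub: "y \<notin> ball x (lam - x $ 1)" if "y \<in> ?H" for y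
      using that component_le_norm_cart[of "y - x" 1] x by (auto simp: dist_norm norm_minus_commute)
    have "0 < lam - x $ 1" using x by simp
    from integrable_mult_indicator[OF H frac_kernel_tail_integrable[OF s this, of x]]
    have "integrable lebesgue (\<lambda>y. indicator ?H y *\<^sub>R (indicator (- ball x (lam - x $ 1)) y * frac_kernel s (x - y)))" .
    also have "(\<lambda>y. indicator ?H y *\<^sub>R (indicator (- ball x (lam - x $ 1)) y * frac_kernel s (x - y)))
        = (\<lambda>y. indicator ?H y * frac_kernel s (x - y))"
      using sub by (auto simp: fun_eq_iff indicator_def)
    finally show int: "integrable lebesgue (\<lambda>y. indicator ?H y * frac_kernel s (x - y))" .
    \<comment> \<open>Its first coordinates exceed \<open>x $ 1 + 5 * r\<close>, so it lies beyond the hyperplane.\<close>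
    let ?B = "ball (x + (10 * r) *\<^sub>R axis 1 1) (5 * r)"
    define m where "m = (15 * r) powr - (?n + 2 * s)"
    have pt: "m * indicator ?B y \<le> indicator ?H y * frac_kernel s (x - y)" for y
    proof (cases "y \<in> ?B")
      case True
      let ?z = "x + (10 * r) *\<^sub>R axis 1 1 - y"
      have z: "norm ?z < 5 * r" using True by (simp add: dist_norm)
      have "\<bar>?z $ 1\<bar> < 5 * r"
        using component_le_norm_cart[of ?z 1] z by linarith
      then have y1: "x $ 1 + 5 * r < y $ 1" by simp
      have "norm (x - y) \<le> norm ?z + norm ((10 * r) *\<^sub>R (axis 1 1 :: (real, 'n) vec))"
        using norm_triangle_ineq4[of ?z "(10 * r) *\<^sub>R (axis 1 1 :: (real, 'n) vec)"] by simp
      then have "norm (x - y) \<le> 15 * r"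
        using z r by (simp add: norm_axis_1)
      moreover have "0 < norm (x - y)"
        using y1 r by auto
      ultimately have "m \<le> frac_kernel s (x - y)"
        unfolding m_def frac_kernel_def using s by (intro powr_mono2') auto
      then show ?thesis using True y1 d by simp
    qed simp
    have "c * r powr - (2 * s) = m * measure lebesgue ?B"
    proof -
      have "measure lebesgue ?B = unit_ball_vol ?n * (5 * r) ^ CARD('n)"
        using r by (simp add: content_ball)
      moreover have "m = 15 powr - (?n + 2 * s) * r powr - (2 * s) / r ^ CARD('n)"
        using r by (simp add: m_def powr_mult powr_diff powr_minus powr_realpow[symmetric] powr_add field_simps)
      ultimately show ?thesis
        using r by (simp add: c_def power_mult_distrib)
    qed
    also have "\<dots> = (LINT y|lebesgue. m * indicator ?B y)"
      by simp
    also have "\<dots> \<le> (LINT y|lebesgue. indicator ?H y * frac_kernel s (x - y))"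
    proof (rule integral_mono[OF _ int pt])
      show "integrable lebesgue (\<lambda>y. m * indicator ?B y)"
        using r by (intro integrable_mult_right integrable_real_indicator) (simp_all add: emeasure_ball)
    qed
    finally show "c * r powr - (2 * s) \<le> (LINT y|lebesgue. indicator ?H y * frac_kernel s (x - y))" .
  qed
qed

section \<open>Maximum principles for antisymmetric functions\<close>

lemma frac_laplacian_touching_below:
  fixes x :: "(real, 'n::{finite,one}) vec"
  assumes s: "0 < s" "s < 1" and u: "u \<in> C11_loc \<Omega>" "u \<in> L_frac s" and \<Omega>: "open \<Omega>" "x \<in> \<Omega>"
    and r: "0 < r"
    and touch: "\<And>y. y \<in> ball x r \<Longrightarrow> u x + v \<bullet> (y - x) - A * (norm (y - x))\<^sup>2 \<le> u y"
  shows "integrable lebesgue (pv_integrand s u x v r)"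
    and "frac_laplacian s u x = frac_laplacian_const TYPE('n) s * (LINT y|lebesgue. pv_integrand s u x v r y)"
proof -
  obtain g \<rho> L where g: "GDERIV u x :> g" and \<rho>: "0 < \<rho>"
    and taylor: "\<forall>y\<in>cball x \<rho>. \<bar>u y - u x - g \<bullet> (y - x)\<bar> \<le> L * (norm (y - x))\<^sup>2"
    by (rule C11_loc_taylor[OF u(1) \<Omega>])
  have "g = v"
    by (rule GDERIV_touching_below[OF g r touch])
  with taylor show F: "integrable lebesgue (pv_integrand s u x v r)"
    by (intro pv_integrand_integrable[OF s u(2) r \<rho>]) blast
  show "frac_laplacian s u x = frac_laplacian_const TYPE('n) s * (LINT y|lebesgue. pv_integrand s u x v r y)"
    by (rule frac_laplacian_eq_integral[OF s(1) u(2) r F])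
qed

lemma not_in_ball_reflect:
  assumes "r \<le> lam - x $ 1" "y $ 1 < lam"
  shows "reflect lam y \<notin> ball x r"
proof -
  have "lam - x $ 1 < \<bar>(reflect lam y - x) $ 1\<bar>"
    using assms by (simp add: reflect_nth_one)
  then show ?thesis
    using component_le_norm_cart[of "reflect lam y - x" 1] assms
    by (simp add: dist_norm norm_minus_commute)
qed

text \<open>
  At a zero \<open>x\<close> of a nonnegative antisymmetric \<open>u\<close> the folded integrand is
  \<open>- u y * (K(x - y) - K(x - reflect lam y))\<close>, where \<open>K\<close> is the kernel. The difference of kernels is
  positive, so a vanishing integral forces \<open>u = 0\<close> almost everywhere in the half space, and
  everywhere in \<open>\<Omega>\<close> by continuity.
\<close>

lemma strong_maximum_principle:
  fixes u :: "(real, 'n::{finite,one}) vec \<Rightarrow> real"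
  assumes s: "0 < s" "s < 1" and u: "u \<in> C11_loc \<Omega>" "u \<in> L_frac s"
    and \<Omega>: "open \<Omega>" "\<Omega> \<subseteq> half_space lam"
    and nonneg: "\<And>y. y \<in> half_space lam \<Longrightarrow> 0 \<le> u y"
    and anti: "\<And>y. y \<in> half_space lam \<Longrightarrow> u (reflect lam y) = - u y"
    and x: "x \<in> \<Omega>" "u x = 0" and eq: "frac_laplacian s u x = 0"
    and y: "y \<in> \<Omega>"
  shows "u y = 0"
proof (rule ccontr)
  assume uy: "u y \<noteq> 0"
  obtain r where r: "0 < r" "ball x r \<subseteq> \<Omega>"
    using \<Omega>(1) x(1) open_contains_ball by blast
  have touch: "u x + 0 \<bullet> (z - x) - 0 * (norm (z - x))\<^sup>2 \<le> u z" if "z \<in> ball x r" for z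
  proof -
    have "z \<in> half_space lam" using that r(2) \<Omega>(2) by blast
    then show ?thesis using nonneg[of z] x(2) by simp
  qed
  let ?F = "pv_integrand s u x 0 r"
  note F = frac_laplacian_touching_below[OF s u \<Omega>(1) x(1) r(1) touch]
  let ?G = "\<lambda>z. ?F z + ?F (reflect lam z)"
  have x1: "x $ 1 < lam" using x(1) \<Omega>(2) by (auto simp: half_space_def)
  have G: "?G z = - (u z * (frac_kernel s (x - z) - frac_kernel s (x - reflect lam z)))"
    if "z $ 1 < lam" for z
    using anti[of z] that by (simp add: pv_integrand_def half_space_def x(2) algebra_simps)
  have gap: "0 < frac_kernel s (x - z) - frac_kernel s (x - reflect lam z)"
    if "z $ 1 < lam" "z \<noteq> x" for z
    using frac_kernel_reflect_less[OF s(1) x1 that] by simp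
  have intG: "integrable lebesgue (\<lambda>z. - ?G z)"
    by (intro integrable_minus integral_reflect(1)[OF F(1)])
  have "AE z in lebesgue. 0 \<le> - ?G z"
  proof (rule AE_reflection_symmetric[of lam x])
    fix z :: "(real, 'n) vec" assume z: "z $ 1 < lam" "z \<noteq> x"
    have "0 \<le> u z" using nonneg[of z] z(1) by (simp add: half_space_def)
    then show "0 \<le> - ?G z"
      unfolding G[OF z(1)] minus_minus using gap[OF z] by (intro mult_nonneg_nonneg) auto
  qed (simp add: add.commute)
  moreover have "(LINT z|lebesgue. ?G z) = 0"
    using eq F(2) frac_laplacian_const_pos[OF s, where 'n = 'n] integral_reflect(2)[OF F(1), of lam]
    by simp
  then have "(LINT z|lebesgue. - ?G z) = 0"
    by (simp only: Bochner_Integration.integral_minus)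
  ultimately have ae: "AE z in lebesgue. - ?G z = 0"
    by (rule iffD1[OF integral_nonneg_eq_0_iff_AE[OF intG]])
  have cont: "continuous_on \<Omega> u"
  proof (rule continuous_at_imp_continuous_on, rule ballI)
    fix z assume "z \<in> \<Omega>"
    with u(1) obtain g where "GDERIV u z :> g" unfolding C11_loc_def by blast
    then show "isCont u z" unfolding gderiv_def by (rule has_derivative_continuous)
  qed
  have "open (\<Omega> \<inter> u -` (- {0}))"
    using cont \<Omega>(1) by (rule continuous_open_preimage) auto
  moreover have "\<Omega> \<inter> u -` (- {0}) \<noteq> {}" using y uy by auto
  ultimately obtain z where z: "z \<in> \<Omega> \<inter> u -` (- {0})" "- ?G z = 0"
    using ae by (rule open_AE_witness)
  then have "z $ 1 < lam" "z \<noteq> x" "u z \<noteq> 0"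
    using \<Omega>(2) x(2) by (auto simp: half_space_def)
  then show False using z(2) gap[of z] G[of z] by simp
qed

text \<open>
  Antisymmetry turns the upper bound at the reflected point into a lower bound. On bounded sets
  lower semicontinuity up to the boundary gives a minimum.
\<close>

lemma antisymmetric_lower_growth:
  fixes u :: "(real, 'n::{finite,one}) vec \<Rightarrow> real"
  assumes \<gamma>: "0 < \<gamma>" "\<gamma> < 2"
    and lsc: "lower_semicontinuous_on (closure \<Omega>) u"
    and grow: "eventually (\<lambda>y. u y \<le> norm y powr \<gamma>) at_infinity"
    and nonneg: "\<And>y. y \<in> half_space lam - \<Omega> \<Longrightarrow> 0 \<le> u y"
    and anti: "\<And>y. y \<in> half_space lam \<Longrightarrow> u (reflect lam y) = - u y"
  shows "\<exists>B\<ge>0. \<forall>y\<in>half_space lam. - B * (1 + norm y powr \<gamma>) \<le> u y"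
proof -
  obtain R where R: "\<And>y. R \<le> norm y \<Longrightarrow> u y \<le> norm y powr \<gamma>"
    using grow unfolding eventually_at_infinity by blast
  define R' where "R' = max R 0 + 2 * \<bar>lam\<bar>"
  let ?K = "closure \<Omega> \<inter> cball 0 R'"
  have "compact ?K" by (intro closed_Int_compact) auto
  have "\<exists>b. \<forall>y\<in>?K. b \<le> u y"
  proof (cases "?K = {}")
    case False
    have "lower_semicontinuous_on ?K u"
      using lsc by (rule lower_semicontinuous_on_subset) blast
    then obtain x where "x \<in> ?K" "\<forall>y\<in>?K. u x \<le> u y"
      by (rule lower_semicontinuous_on_attains_min[OF \<open>compact ?K\<close> False])
    then show ?thesis by blast
  qed auto
  then obtain b where b: "\<And>y. y \<in> ?K \<Longrightarrow> b \<le> u y" by blast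
  define B where "B = max 4 \<bar>b\<bar>"
  have "- B * (1 + norm y powr \<gamma>) \<le> u y" if y: "y \<in> half_space lam" for y
  proof (cases "R' \<le> norm y")
    case True
    have "norm y \<le> norm (reflect lam y) + 2 * \<bar>lam\<bar>"
      using norm_reflect_le[of lam "reflect lam y"] by simp
    then have "R \<le> norm (reflect lam y)" using True by (simp add: R'_def)
    then have "- u y \<le> norm (reflect lam y) powr \<gamma>"
      using R[of "reflect lam y"] anti[OF y] by simp
    also have "\<dots> \<le> (2 * norm y) powr \<gamma>"
      using norm_reflect_le[of lam y] True \<gamma> by (intro powr_mono2) (auto simp: R'_def)
    also have "\<dots> = 2 powr \<gamma> * norm y powr \<gamma>" by (intro powr_mult) 
    also have "\<dots> \<le> B * norm y powr \<gamma>"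
    proof (rule mult_right_mono)
      have "2 powr \<gamma> \<le> (2::real) powr 2" using \<gamma> by (intro powr_mono) auto
      then show "2 powr \<gamma> \<le> B" by (simp add: B_def)
    qed simp
    also have "\<dots> \<le> B * (1 + norm y powr \<gamma>)"
      by (rule mult_left_mono) (simp_all add: B_def)
    finally show ?thesis by simp
  next
    case False
    have "- B * (1 + norm y powr \<gamma>) \<le> - B"
      by (simp add: B_def algebra_simps)
    moreover have "- B \<le> u y"
    proof (cases "y \<in> \<Omega>")
      case True
      then have "y \<in> ?K" using False closure_subset by auto
      from b[OF this] show ?thesis by (simp add: B_def)
    next
      case False
      then show ?thesis using nonneg[of y] y by (simp add: B_def)
    qed
    ultimately show ?thesis by linarith
  qed
  then show ?thesis by (intro exI[of _ B]) (auto simp: B_def)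
qed

text \<open>
  The paraboloid replaces a minimum of \<open>u\<close>, which need not be attained: \<open>x0\<close> is an almost minimal
  point, the opening \<open>A\<close> is just large enough to force the minimum of \<open>u + A * norm (_ - x0)\<^sup>2\<close>
  over the ball of radius \<open>2 * r\<close> into the closed ball of radius \<open>r\<close>, and it is proportional to
  \<open>P / r\<^sup>2\<close> with a small factor, so that its contribution scales like all the others.
  Negativity of \<open>u x0\<close> keeps the minimum point inside \<open>\<Omega>\<close>.
\<close>

lemma touching_point_near:
  fixes u :: "'a::euclidean_space \<Rightarrow> real"
  assumes lsc: "lower_semicontinuous_on (closure \<Omega>) u" and x0: "x0 \<in> \<Omega>"
    and r: "0 < r"
    and nonneg: "\<And>y. y \<in> ball x0 (2 * r) \<Longrightarrow> y \<notin> \<Omega> \<Longrightarrow> 0 \<le> u y"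
    and \<epsilon>: "0 < \<epsilon>" "\<epsilon> < 1" and P: "0 < P"
    and low: "\<And>y. y \<in> ball x0 (2 * r) \<Longrightarrow> - P * (1 + 2 * \<epsilon>) \<le> u y"
    and ux0: "u x0 \<le> - P * (1 - \<epsilon>)" and A: "A * r\<^sup>2 = 3 * \<epsilon> * P"
  shows "\<exists>x v. x \<in> \<Omega> \<and> norm (x - x0) \<le> r \<and> u x \<le> u x0 \<and> norm v * r \<le> 6 * \<epsilon> * P
    \<and> (\<forall>y\<in>ball x r. u x + v \<bullet> (y - x) - A * (norm (y - x))\<^sup>2 \<le> u y)"
proof -
  have A0: "0 < A"
  proof -
    have "A = 3 * \<epsilon> * P / r\<^sup>2" using A r by (simp add: field_simps)
    then show ?thesis using \<epsilon> P r by simp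
  qed
  have neg: "u x0 < 0"
  proof -
    have "0 < P * (1 - \<epsilon>)" using P \<epsilon> by (intro mult_pos_pos) auto
    then show ?thesis using ux0 by simp
  qed
  let ?f = "\<lambda>y. u y + A * (norm (y - x0))\<^sup>2"
  let ?K = "closure \<Omega> \<inter> cball x0 r"
  have K: "compact ?K" by (intro closed_Int_compact) auto
  have x0K: "x0 \<in> ?K" using x0 r closure_subset by auto
  then have ne: "?K \<noteq> {}" by blast
  have "lower_semicontinuous_on ?K ?f"
    by (intro lower_semicontinuous_on_add lower_semicontinuous_on_subset[OF lsc] continuous_intros) auto
  then obtain x where x: "x \<in> ?K" and min: "\<forall>y\<in>?K. ?f x \<le> ?f y"
    by (rule lower_semicontinuous_on_attains_min[OF K ne])
  have fx: "?f x \<le> u x0" using bspec[OF min x0K] by simp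
  moreover have "0 \<le> A * (norm (x - x0))\<^sup>2" using A0 by simp
  ultimately have ux: "u x \<le> u x0" by linarith
  have xr: "norm (x - x0) \<le> r" using x by (simp add: dist_norm norm_minus_commute)
  have x\<Omega>: "x \<in> \<Omega>"
    using nonneg[of x] ux neg xr r by (force simp: dist_norm norm_minus_commute)
  define v where "v = - ((2 * A) *\<^sub>R (x - x0))"
  have "norm v * r = 2 * A * (norm (x - x0) * r)"
    using A0 by (simp add: v_def)
  also have "\<dots> \<le> 2 * A * (r * r)"
    using xr r A0 by (intro mult_left_mono mult_right_mono) auto
  also have "\<dots> = 6 * \<epsilon> * P"
    using A by (simp add: power2_eq_square)
  finally have v: "norm v * r \<le> 6 * \<epsilon> * P" .
  have glob: "?f x \<le> ?f y" if y: "y \<in> ball x0 (2 * r)" for y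
  proof (cases "y \<in> \<Omega>")
    case False
    have "0 \<le> ?f y"
      using nonneg[OF y False] A0 by simp
    then show ?thesis using fx neg by linarith
  next
    case True
    show ?thesis
    proof (cases "y \<in> cball x0 r")
      case True
      with \<open>y \<in> \<Omega>\<close> have "y \<in> ?K" using closure_subset by auto
      then show ?thesis by (rule bspec[OF min])
    next
      case False
      then have "r\<^sup>2 \<le> (norm (y - x0))\<^sup>2"
        using r by (intro power_mono) (auto simp: dist_norm norm_minus_commute)
      then have "3 * \<epsilon> * P \<le> A * (norm (y - x0))\<^sup>2"
        unfolding A[symmetric] using A0 by (intro mult_left_mono) auto
      moreover have "- P * (1 - \<epsilon>) = - P * (1 + 2 * \<epsilon>) + 3 * \<epsilon> * P"
        by (simp add: algebra_simps)
      ultimately show ?thesis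
        using low[OF y] ux0 fx by linarith
    qed
  qed
  have "u x + v \<bullet> (y - x) - A * (norm (y - x))\<^sup>2 \<le> u y" if y: "y \<in> ball x r" for y
  proof -
    have "dist x0 y \<le> dist x0 x + dist x y" by (rule dist_triangle)
    then have "y \<in> ball x0 (2 * r)"
      using y xr by (simp add: dist_norm norm_minus_commute)
    from glob[OF this] have "u x + A * ((norm (x - x0))\<^sup>2 - (norm (y - x0))\<^sup>2) \<le> u y"
      by (simp add: algebra_simps)
    moreover have "(norm (y - x0))\<^sup>2 = (norm (y - x))\<^sup>2 + 2 * ((x - x0) \<bullet> (y - x)) + (norm (x - x0))\<^sup>2"
    proof -
      have "y - x0 = (y - x) + (x - x0)" by simp
      moreover have "(norm (a + b))\<^sup>2 = (norm a)\<^sup>2 + 2 * (b \<bullet> a) + (norm b)\<^sup>2" for a b :: 'a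
        by (simp add: power2_norm_eq_inner inner_add_left inner_add_right inner_commute)
      ultimately show ?thesis by metis
    qed
    ultimately show ?thesis
      by (simp add: v_def algebra_simps)
  qed
  with x\<Omega> xr ux v show ?thesis by blast
qed

text \<open>
  The comparison at the touching point. In the folded integrand the value \<open>u y\<close> has the factor
  \<open>K(x - reflect lam y) - K(x - y) \<le> 0\<close>, hence it may be replaced by its lower bound: the paraboloid on the ball,
  the weight elsewhere. What is left is the paraboloid against the kernel on the ball, small errors
  off the ball, and \<open>2 * u x\<close>, about \<open>- 2 * P\<close>, against the reflected kernel; since \<open>\<epsilon> \<le> 1 / 8\<close>, at
  least half of the last term survives the errors there. By reflection its mass is that of the kernel
  beyond the hyperplane.
\<close>

lemma pv_integral_upper_bound:
  fixes x v :: "(real, 'n::{finite,one}) vec"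
  assumes s: "0 < s" "s < 1" and \<gamma>: "\<gamma> < 2 * s"
    and F: "integrable lebesgue (pv_integrand s u x v r)"
    and anti: "\<And>y. y \<in> half_space lam \<Longrightarrow> u (reflect lam y) = - u y"
    and r: "0 < r" "r \<le> lam - x $ 1" "lam - x $ 1 \<le> 5 * r"
    and \<epsilon>: "0 < \<epsilon>" "\<epsilon> \<le> 1 / 8" and \<delta>: "0 \<le> \<delta>" and P: "0 < P" and A: "0 \<le> A"
    and touch: "\<And>y. y \<in> ball x r \<Longrightarrow> u x + v \<bullet> (y - x) - A * (norm (y - x))\<^sup>2 \<le> u y"
    and far: "\<And>y. y \<in> half_space lam \<Longrightarrow> y \<notin> ball x r \<Longrightarrow> - P * (1 + \<epsilon> + \<delta> * norm (y - x) powr \<gamma>) \<le> u y"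
    and ux: "u x \<le> - P * (1 - \<epsilon>)" and v: "norm v * r \<le> 6 * \<epsilon> * P"
  shows "(LINT y|lebesgue. pv_integrand s u x v r y)
     \<le> A * (LINT y|lebesgue. indicator (cball x r) y * ((norm (y - x))\<^sup>2 * frac_kernel s (x - y)))
      + 2 * \<epsilon> * P * (LINT y|lebesgue. indicator (- ball x r) y * frac_kernel s (x - y))
      + \<delta> * P * (LINT y|lebesgue. indicator (- ball x r) y * (norm (y - x) powr \<gamma> * frac_kernel s (x - y)))
      - P * (LINT y|lebesgue. indicator {y. lam \<le> y $ 1} y * frac_kernel s (x - y))"
proof -
  let ?F = "pv_integrand s u x v r"
  define b1 where "b1 = (\<lambda>y. indicator (cball x r) y * ((norm (y - x))\<^sup>2 * frac_kernel s (x - y)))"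
  define b2 where "b2 = (\<lambda>y. indicator (- ball x r) y * frac_kernel s (x - y))"
  define b3 where "b3 = (\<lambda>y. indicator (- ball x r) y * (norm (y - x) powr \<gamma> * frac_kernel s (x - y)))"
  define b4 where "b4 = (\<lambda>y. indicator {y. lam \<le> y $ 1} y * frac_kernel s (x - y))"
  let ?B = "\<lambda>y. A * b1 y + 2 * \<epsilon> * P * b2 y + \<delta> * P * b3 y - P * b4 y"
  have x1: "x $ 1 < lam" using r by simp
  have i1: "integrable lebesgue b1"
    using frac_kernel_near[OF s(2), where 'n = 'n] r(1) unfolding b1_def by auto
  have i2: "integrable lebesgue b2"
    unfolding b2_def by (rule frac_kernel_tail_integrable[OF s(1) r(1)])
  have i3: "integrable lebesgue b3"
    using frac_kernel_tail[OF \<gamma>, where 'n = 'n] r(1) unfolding b3_def by auto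
  have i4: "integrable lebesgue b4"
    using frac_kernel_mass_beyond[OF s(1), where 'n = 'n] r x1 unfolding b4_def by blast
  have b0: "0 \<le> b1 y" "0 \<le> b2 y" "0 \<le> b3 y" for y
    by (simp_all add: b1_def b2_def b3_def)
  have "(LINT y|lebesgue. ?F y) \<le> (LINT y|lebesgue. ?B y)"
  proof (rule integral_mono_reflect[OF F])
    show "integrable lebesgue ?B"
      by (intro Bochner_Integration.integrable_diff Bochner_Integration.integrable_add integrable_mult_right i1 i2 i3 i4)
    fix y :: "(real, 'n) vec" assume y: "y $ 1 < lam" "y \<noteq> x"
    let ?K = "frac_kernel s (x - y)" and ?K' = "frac_kernel s (x - reflect lam y)"
    have K: "?K' \<le> ?K" "0 \<le> ?K'"
      using frac_kernel_reflect_less[OF s(1) x1 y] by simp_all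
    have yh: "y \<in> half_space lam" using y by (simp add: half_space_def)
    have Ry: "reflect lam y \<notin> ball x r"
      by (rule not_in_ball_reflect[OF r(2) y(1)])
    have FR: "?F (reflect lam y) = (u x + u y) * ?K'"
      using Ry by (simp add: pv_integrand_def anti[OF yh])
    have BR: "- P * ?K' \<le> ?B (reflect lam y)"
    proof -
      have "b4 (reflect lam y) = ?K'"
        using y(1) by (simp add: b4_def reflect_nth_one)
      moreover have "0 \<le> A * b1 (reflect lam y) + 2 * \<epsilon> * P * b2 (reflect lam y) + \<delta> * P * b3 (reflect lam y)"
        using b0 A \<epsilon> \<delta> P by (intro add_nonneg_nonneg mult_nonneg_nonneg) auto
      ultimately show ?thesis by simp
    qed
    \<comment> \<open>Monotonicity of the folded integrand in the value at \<open>y\<close>.\<close>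
    have shift: "(a - u y) * ?K + (b + u y) * ?K' \<le> (a - t) * ?K + (b + t) * ?K'" if "t \<le> u y" for a b t
    proof -
      have "0 \<le> (u y - t) * (?K - ?K')" using that K by (intro mult_nonneg_nonneg) auto
      then show ?thesis by (simp add: algebra_simps)
    qed
    have b4y: "b4 y = 0" using y(1) by (simp add: b4_def)
    show "?F y + ?F (reflect lam y) \<le> ?B y + ?B (reflect lam y)"
    proof (cases "y \<in> ball x r")
      case True
      let ?q = "v \<bullet> (y - x)" and ?d = "A * (norm (y - x))\<^sup>2"
      have "?F y = ((u x + ?q) - u y) * ?K"
        using True by (simp add: pv_integrand_def)
      then have "?F y + ?F (reflect lam y) \<le> ?d * ?K + (u x + (u x + ?q - ?d)) * ?K'"
        using shift[OF touch[OF True], of "u x + ?q" "u x"] FR by simp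
      also have "(u x + (u x + ?q - ?d)) * ?K' \<le> - P * ?K'"
      proof (rule mult_right_mono[OF _ K(2)])
        have "?q \<le> norm v * norm (y - x)" by (rule norm_cauchy_schwarz)
        also have "\<dots> \<le> norm v * r"
          using True by (intro mult_left_mono) (auto simp: dist_norm norm_minus_commute)
        finally have "?q \<le> 6 * \<epsilon> * P" using v by simp
        moreover have "8 * (\<epsilon> * P) \<le> P" using \<epsilon> P by simp
        moreover have "0 \<le> ?d" using A by simp
        moreover have "u x \<le> \<epsilon> * P - P" using ux by (simp add: algebra_simps)
        ultimately show "u x + (u x + ?q - ?d) \<le> - P" by linarith
      qed
      also have "?d * ?K = ?B y"
        using True b4y by (simp add: b1_def b2_def b3_def)
      finally show ?thesis using BR by simp
    next
      case False
      let ?t = "- P * (1 + \<epsilon> + \<delta> * norm (y - x) powr \<gamma>)"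
      have "?F y = (u x - u y) * ?K"
        using False by (simp add: pv_integrand_def)
      then have "?F y + ?F (reflect lam y) \<le> (u x - ?t) * ?K + (u x + ?t) * ?K'"
        using shift[OF far[OF yh False], of "u x" "u x"] FR by simp
      also have "(u x + ?t) * ?K' \<le> - P * ?K'"
      proof (rule mult_right_mono[OF _ K(2)])
        have "0 \<le> P * (\<delta> * norm (y - x) powr \<gamma>)" using P \<delta> by simp
        moreover have "?t = - P - P * \<epsilon> - P * (\<delta> * norm (y - x) powr \<gamma>)" by (simp add: algebra_simps)
        moreover have "u x \<le> P * \<epsilon> - P" using ux by (simp add: algebra_simps)
        ultimately show "u x + ?t \<le> - P" using P by linarith
      qed
      also have "(u x - ?t) * ?K \<le> (2 * \<epsilon> * P + \<delta> * P * norm (y - x) powr \<gamma>) * ?K"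
        by (rule mult_right_mono) (use ux in \<open>simp_all add: algebra_simps\<close>)
      also have "\<dots> \<le> ?B y"
        using False b4y b0(1)[of y] A by (simp add: b2_def b3_def algebra_simps)
      finally show ?thesis using BR by simp
    qed
  qed
  also have "\<dots> = A * (LINT y|lebesgue. b1 y) + 2 * \<epsilon> * P * (LINT y|lebesgue. b2 y)
      + \<delta> * P * (LINT y|lebesgue. b3 y) - P * (LINT y|lebesgue. b4 y)"
    by (simp add: i1 i2 i3 i4)
  finally show ?thesis
    unfolding b1_def b2_def b3_def b4_def .
qed

section \<open>Narrow regions\<close>

text \<open>
  The potential \<open>c\<close> carries no bound here, so that its lower bound can appear explicitly in the estimate of the
  width.
\<close>

definition narrow_problem ::
    "real \<Rightarrow> real \<Rightarrow> real \<Rightarrow> real \<Rightarrow> (real, 'n::{finite,one}) vec set \<Rightarrow> ((real, 'n) vec \<Rightarrow> real) \<Rightarrow> ((real, 'n) vec \<Rightarrow> real) \<Rightarrow> bool" where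
  "narrow_problem s \<gamma> lam l \<Omega> w c \<longleftrightarrow>
     open \<Omega> \<and> \<Omega> \<subseteq> {x. lam - 2 * l < x $ 1 \<and> x $ 1 < lam} \<and>
     w \<in> C11_loc \<Omega> \<inter> L_frac s \<and> lower_semicontinuous_on (closure \<Omega>) w \<and>
     0 < \<gamma> \<and> \<gamma> < 2 * s \<and> (\<forall>\<^sub>F x in at_infinity. w x \<le> norm x powr \<gamma>) \<and>
     (\<forall>x\<in>\<Omega>. frac_laplacian s w x + c x * w x = 0) \<and>
     (\<forall>x\<in>half_space lam - \<Omega>. 0 \<le> w x) \<and>
     (\<forall>x\<in>half_space lam. w (reflect lam x) = - w x)"

lemma negative_value_near_weighted_infimum:
  fixes u h :: "'a \<Rightarrow> real"
  assumes h: "\<And>y. y \<in> S \<Longrightarrow> 0 < h y" and B: "\<And>y. y \<in> S \<Longrightarrow> - B * h y \<le> u y"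
    and neg: "z \<in> S" "u z < 0" and \<epsilon>: "0 < \<epsilon>"
  shows "\<exists>\<mu> x. 0 < \<mu> \<and> x \<in> S \<and> (\<forall>y\<in>S. - \<mu> * h y \<le> u y) \<and> u x \<le> - \<mu> * (1 - \<epsilon>) * h x"
proof -
  let ?Q = "(\<lambda>y. u y / h y) ` S"
  define \<mu> where "\<mu> = - Inf ?Q"
  have bdd: "bdd_below ?Q"
  proof (rule bdd_belowI2)
    fix y assume y: "y \<in> S"
    show "- B \<le> u y / h y" using B[OF y] h[OF y] by (simp add: pos_le_divide_eq)
  qed
  have "Inf ?Q \<le> u z / h z" using neg(1) bdd by (intro cInf_lower) auto
  also have "\<dots> < 0" using h[OF neg(1)] neg(2) by (simp add: divide_neg_pos)
  finally have \<mu>: "0 < \<mu>" by (simp add: \<mu>_def)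
  have low: "- \<mu> * h y \<le> u y" if y: "y \<in> S" for y
  proof -
    have "- \<mu> \<le> u y / h y" unfolding \<mu>_def minus_minus using y bdd by (intro cInf_lower) auto
    then show ?thesis using h[OF y] by (simp add: pos_le_divide_eq)
  qed
  have "Inf ?Q < - \<mu> * (1 - \<epsilon>)"
    using mult_pos_pos[OF \<mu> \<epsilon>] by (simp add: \<mu>_def algebra_simps)
  then obtain x where x: "x \<in> S" "u x / h x < - \<mu> * (1 - \<epsilon>)"
    using cInf_lessD[of ?Q] neg(1) by blast
  then have "u x \<le> - \<mu> * (1 - \<epsilon>) * h x"
    using h[OF x(1)] by (simp add: pos_divide_less_eq)
  with \<mu> low x(1) show ?thesis by blast
qed

text \<open>
  The quantitative form of the maximum principle: a negative value costs width. Let \<open>- \<mu>\<close> be the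
  infimum of \<open>w / h\<close> over the half space for the weight \<open>h = M + norm _ powr \<gamma>\<close>, let \<open>x0\<close> be a point
  where it is almost attained, at distance \<open>4 * r\<close> from the hyperplane, and \<open>P = \<mu> * h x0\<close>. At the
  touching point near \<open>x0\<close> all terms of the upper bound scale like \<open>P * r powr - (2 * s)\<close>, and
  \<open>\<epsilon>\<close> and \<open>\<delta>\<close> make the positive ones at most half of the mass \<open>m\<close> beyond the hyperplane. On the other
  hand, the equation bounds the fractional Laplacian from below by \<open>- 2 * P * \<bar>C\<bar>\<close>. Comparing the
  two gives the claim. The constants \<open>N\<close>, \<open>T\<close>, \<open>m\<close>, \<open>\<epsilon>\<close> depend on the dimension and on \<open>s\<close> only;
  those that depend on \<open>\<gamma>\<close> are absorbed by \<open>\<delta>\<close>, that is, by \<open>M\<close>.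
\<close>

lemma negative_value_needs_width:
  fixes s :: real
  assumes s: "0 < s" "s < 1"
  shows "\<exists>k>0. \<forall>(\<gamma> :: real) lam l (\<Omega> :: (real, 'n::{finite,one}) vec set) w c C.
    narrow_problem s \<gamma> lam l \<Omega> w c \<longrightarrow> 0 < l \<longrightarrow> l \<le> 1 \<longrightarrow> (\<forall>x\<in>\<Omega>. C \<le> c x) \<longrightarrow>
    (\<exists>x\<in>half_space lam. w x < 0) \<longrightarrow> k \<le> \<bar>C\<bar> * l powr (2 * s)"
proof -
  from frac_kernel_near[OF s(2), where 'n = 'n] obtain N where "0 < N" and
    N: "\<forall>(x :: (real, 'n) vec). \<forall>r>0. integrable lebesgue (\<lambda>y. indicator (cball x r) y * ((norm (y - x))\<^sup>2 * frac_kernel s (x - y))) \<and>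
      (LINT y|lebesgue. indicator (cball x r) y * ((norm (y - x))\<^sup>2 * frac_kernel s (x - y))) \<le> N * r powr (2 - 2 * s)"
    by (elim exE conjE) (rule that)
  from frac_kernel_mass_tail[OF s(1), where 'n = 'n] obtain T where "0 < T" and
    T: "\<forall>(x :: (real, 'n) vec). \<forall>r>0. integrable lebesgue (\<lambda>y. indicator (- ball x r) y * frac_kernel s (x - y)) \<and>
      (LINT y|lebesgue. indicator (- ball x r) y * frac_kernel s (x - y)) \<le> T * r powr - (2 * s)"
    by (elim exE conjE) (rule that)
  from frac_kernel_mass_beyond[OF s(1), where 'n = 'n] obtain m where "0 < m" and
    m: "\<forall>(x :: (real, 'n) vec) lam r. 0 < r \<longrightarrow> x $ 1 < lam \<longrightarrow> lam - x $ 1 \<le> 5 * r \<longrightarrow>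
      integrable lebesgue (\<lambda>y. indicator {y. lam \<le> y $ 1} y * frac_kernel s (x - y)) \<and>
      m * r powr - (2 * s) \<le> (LINT y|lebesgue. indicator {y. lam \<le> y $ 1} y * frac_kernel s (x - y))"
    by (elim exE conjE) (rule that)
  define \<kappa> where "\<kappa> = frac_laplacian_const TYPE('n) s"
  have \<kappa>: "0 < \<kappa>" unfolding \<kappa>_def by (rule frac_laplacian_const_pos[OF s])
  define \<epsilon> where "\<epsilon> = min (1 / 8) (m / (4 * (3 * N + 2 * T)))"
  have \<epsilon>: "0 < \<epsilon>" "\<epsilon> \<le> 1 / 8"
    using \<open>0 < m\<close> \<open>0 < N\<close> \<open>0 < T\<close> by (simp_all only: \<epsilon>_def min.cobounded1) simp
  have \<epsilon>NT: "3 * \<epsilon> * N + 2 * \<epsilon> * T \<le> m / 4"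
  proof -
    have pos: "0 < 4 * (3 * N + 2 * T)" using \<open>0 < N\<close> \<open>0 < T\<close> by simp
    have "\<epsilon> \<le> m / (4 * (3 * N + 2 * T))" by (simp add: \<epsilon>_def)
    then have "\<epsilon> * (4 * (3 * N + 2 * T)) \<le> m" using pos by (simp only: pos_le_divide_eq)
    then show ?thesis by (simp add: algebra_simps)
  qed
  define k where "k = \<kappa> * m / 4"
  have k: "0 < k" using \<kappa> \<open>0 < m\<close> by (simp add: k_def)
  show ?thesis
  proof (intro exI[of _ k] conjI k allI impI)
    fix \<gamma> lam l C :: real and \<Omega> :: "(real, 'n) vec set" and w c :: "(real, 'n) vec \<Rightarrow> real"
    assume prob: "narrow_problem s \<gamma> lam l \<Omega> w c" and l: "0 < l" "l \<le> 1"
      and c: "\<forall>x\<in>\<Omega>. C \<le> c x" and neg: "\<exists>x\<in>half_space lam. w x < 0"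
    have \<Omega>: "open \<Omega>" "\<Omega> \<subseteq> {x. lam - 2 * l < x $ 1 \<and> x $ 1 < lam}"
      and w: "w \<in> C11_loc \<Omega>" "w \<in> L_frac s" and lsc: "lower_semicontinuous_on (closure \<Omega>) w"
      and \<gamma>: "0 < \<gamma>" "\<gamma> < 2 * s" and grow: "\<forall>\<^sub>F x in at_infinity. w x \<le> norm x powr \<gamma>"
      and eq: "\<And>x. x \<in> \<Omega> \<Longrightarrow> frac_laplacian s w x + c x * w x = 0"
      and nonneg: "\<And>x. x \<in> half_space lam - \<Omega> \<Longrightarrow> 0 \<le> w x"
      and anti: "\<And>x. x \<in> half_space lam \<Longrightarrow> w (reflect lam x) = - w x"
      using prob unfolding narrow_problem_def by blast+
    have \<gamma>2: "\<gamma> < 2" using \<gamma> s by simp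
    from frac_kernel_tail[OF \<gamma>(2), where 'n = 'n] obtain T' where "0 < T'" and
      T': "\<forall>(x :: (real, 'n) vec). \<forall>r>0.
        integrable lebesgue (\<lambda>y. indicator (- ball x r) y * (norm (y - x) powr \<gamma> * frac_kernel s (x - y))) \<and>
        (LINT y|lebesgue. indicator (- ball x r) y * (norm (y - x) powr \<gamma> * frac_kernel s (x - y))) \<le> T' * r powr (\<gamma> - 2 * s)"
      by (elim exE conjE) (rule that)
    define \<delta> where "\<delta> = min \<epsilon> (m / (16 * T'))"
    have \<delta>: "0 < \<delta>" "\<delta> \<le> \<epsilon>" using \<epsilon> \<open>0 < m\<close> \<open>0 < T'\<close> by (auto simp: \<delta>_def)
    have \<delta>T: "4 * \<delta> * T' \<le> m / 4"
    proof -
      have "\<delta> \<le> m / (16 * T')" by (simp add: \<delta>_def)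
      then show ?thesis using \<open>0 < T'\<close> by (simp add: field_simps)
    qed
    obtain M where M: "1 \<le> M" and weight: "\<forall>x y :: (real, 'n) vec.
        M + norm y powr \<gamma> \<le> (M + norm x powr \<gamma>) * (1 + \<epsilon> + \<delta> * norm (y - x) powr \<gamma>)"
      using power_weight_growth[OF \<gamma>(1) \<gamma>2 \<epsilon>(1) _ \<delta>(1), where 'a = "(real, 'n) vec"] \<epsilon>(2) by auto
    define h where "h = (\<lambda>y :: (real, 'n) vec. M + norm y powr \<gamma>)"
    have h: "0 < h y" for y using M by (simp add: h_def add_pos_nonneg)
    have hw: "h y \<le> h x * (1 + \<epsilon> + \<delta> * norm (y - x) powr \<gamma>)" for x y
      using weight by (simp add: h_def)
    from antisymmetric_lower_growth[OF \<gamma>(1) \<gamma>2 lsc grow nonneg anti]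
    obtain B where B: "0 \<le> B" "\<forall>y\<in>half_space lam. - B * (1 + norm y powr \<gamma>) \<le> w y" by blast
    have Bh: "- B * h y \<le> w y" if "y \<in> half_space lam" for y
    proof -
      have "B * (1 + norm y powr \<gamma>) \<le> B * h y"
        using B(1) M by (intro mult_left_mono) (auto simp: h_def)
      then show ?thesis using B(2) that by force
    qed
    obtain \<mu> x0 where \<mu>: "0 < \<mu>" and x0h: "x0 \<in> half_space lam"
      and low: "\<forall>y\<in>half_space lam. - \<mu> * h y \<le> w y" and wx0: "w x0 \<le> - \<mu> * (1 - \<epsilon>) * h x0"
      using neg negative_value_near_weighted_infimum[of "half_space lam" h B w, OF h Bh _ _ \<epsilon>(1)] by blast
    define P where "P = \<mu> * h x0"
    have P: "0 < P" using \<mu> h by (simp add: P_def)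
    have wx0P: "w x0 \<le> - P * (1 - \<epsilon>)" using wx0 by (simp add: P_def mult.commute mult.left_commute)
    also have "\<dots> < 0" using mult_pos_pos[OF P, of "1 - \<epsilon>"] \<epsilon> by simp
    finally have "w x0 < 0" .
    then have x0: "x0 \<in> \<Omega>" using nonneg[of x0] x0h by force
    \<comment> \<open>A quarter, so that the ball of radius \<open>2 * r\<close> stays in the half space.\<close>
    define r where "r = (lam - x0 $ 1) / 4"
    have d0: "lam - x0 $ 1 = 4 * r" by (simp add: r_def)
    have r: "0 < r" "2 * r \<le> l" using x0 \<Omega>(2) by (auto simp: r_def)
    have lowP: "- P * (1 + \<epsilon> + \<delta> * norm (y - x0) powr \<gamma>) \<le> w y" if "y \<in> half_space lam" for y
    proof -
      have "\<mu> * h y \<le> \<mu> * (h x0 * (1 + \<epsilon> + \<delta> * norm (y - x0) powr \<gamma>))"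
        using \<mu> hw by (intro mult_left_mono) auto
      then show ?thesis using low that by (force simp: P_def mult.assoc)
    qed
    have ball_half: "y \<in> half_space lam" if "y \<in> ball x0 (2 * r)" for y
    proof -
      have "\<bar>(y - x0) $ 1\<bar> < 2 * r"
        using component_le_norm_cart[of "y - x0" 1] that by (simp add: dist_norm norm_minus_commute)
      then show ?thesis using d0 r(1) by (simp add: half_space_def)
    qed
    have low_near: "- P * (1 + 2 * \<epsilon>) \<le> w y" if y: "y \<in> ball x0 (2 * r)" for y
    proof -
      have "norm (y - x0) \<le> 1" using y r l by (simp add: dist_norm norm_minus_commute)
      then have "norm (y - x0) powr \<gamma> \<le> 1" using \<gamma> by (intro powr_le1) auto
      then have "\<delta> * norm (y - x0) powr \<gamma> \<le> \<epsilon> * 1" using \<delta> \<epsilon> by (intro mult_mono) auto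
      then have "P * (1 + \<epsilon> + \<delta> * norm (y - x0) powr \<gamma>) \<le> P * (1 + 2 * \<epsilon>)"
        using P by (intro mult_left_mono) auto
      then show ?thesis using lowP[OF ball_half[OF y]] by simp
    qed
    define A where "A = 3 * \<epsilon> * P / r\<^sup>2"
    have A: "A * r\<^sup>2 = 3 * \<epsilon> * P" and A0: "0 \<le> A" using r \<epsilon> P by (simp_all add: A_def)
    obtain x v where x: "x \<in> \<Omega>" "norm (x - x0) \<le> r" "w x \<le> w x0" and v: "norm v * r \<le> 6 * \<epsilon> * P"
      and touch: "\<forall>y\<in>ball x r. w x + v \<bullet> (y - x) - A * (norm (y - x))\<^sup>2 \<le> w y"
    proof -
      have "\<exists>x v. x \<in> \<Omega> \<and> norm (x - x0) \<le> r \<and> w x \<le> w x0 \<and> norm v * r \<le> 6 * \<epsilon> * P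
          \<and> (\<forall>y\<in>ball x r. w x + v \<bullet> (y - x) - A * (norm (y - x))\<^sup>2 \<le> w y)"
        using ball_half nonneg \<epsilon>
        by (intro touching_point_near[OF lsc x0 r(1) _ \<epsilon>(1) _ P low_near wx0P A]) auto
      then show thesis using that by blast
    qed
    have wxP: "w x \<le> - P * (1 - \<epsilon>)" using x(3) wx0P by simp
    have wx: "w x < 0" using x(3) \<open>w x0 < 0\<close> by simp
    have dx: "r \<le> lam - x $ 1" "lam - x $ 1 \<le> 5 * r" "x $ 1 < lam"
    proof -
      have "\<bar>(x - x0) $ 1\<bar> \<le> r"
        using component_le_norm_cart[of "x - x0" 1] x(2) by linarith
      then show "r \<le> lam - x $ 1" "lam - x $ 1 \<le> 5 * r" "x $ 1 < lam" using d0 r(1) by auto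
    qed
    have far: "- P * (1 + \<epsilon> + 4 * \<delta> * norm (y - x) powr \<gamma>) \<le> w y"
      if y: "y \<in> half_space lam" "y \<notin> ball x r" for y
    proof -
      have "r \<le> norm (y - x)" using y(2) by (simp add: dist_norm norm_minus_commute)
      then have "norm (y - x0) \<le> 2 * norm (y - x)"
        using norm_triangle_ineq[of "y - x" "x - x0"] x(2) by simp
      then have "norm (y - x0) powr \<gamma> \<le> (2 * norm (y - x)) powr \<gamma>"
        using \<gamma> by (intro powr_mono2) auto
      also have "\<dots> = 2 powr \<gamma> * norm (y - x) powr \<gamma>" by (intro powr_mult)
      also have "\<dots> \<le> 4 * norm (y - x) powr \<gamma>"
      proof (rule mult_right_mono)
        have "2 powr \<gamma> \<le> (2::real) powr 2" using \<gamma>2 by (intro powr_mono) auto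
        then show "2 powr \<gamma> \<le> (4::real)" by simp
      qed simp
      finally have "\<delta> * norm (y - x0) powr \<gamma> \<le> 4 * \<delta> * norm (y - x) powr \<gamma>"
        using \<delta> by simp
      then have "P * (1 + \<epsilon> + \<delta> * norm (y - x0) powr \<gamma>) \<le> P * (1 + \<epsilon> + 4 * \<delta> * norm (y - x) powr \<gamma>)"
        using P by (intro mult_left_mono) auto
      then show ?thesis using lowP[OF y(1)] by simp
    qed
    let ?I = "LINT y|lebesgue. pv_integrand s w x v r y"
    note pv = frac_laplacian_touching_below[OF s w \<Omega>(1) x(1) r(1) bspec[OF touch]]
    have I: "?I \<le> - P * (m / 2) * r powr - (2 * s)"
    proof -
      let ?R = "r powr - (2 * s)"
      have "?I \<le> A * (LINT y|lebesgue. indicator (cball x r) y * ((norm (y - x))\<^sup>2 * frac_kernel s (x - y)))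
        + 2 * \<epsilon> * P * (LINT y|lebesgue. indicator (- ball x r) y * frac_kernel s (x - y))
        + (4 * \<delta>) * P * (LINT y|lebesgue. indicator (- ball x r) y * (norm (y - x) powr \<gamma> * frac_kernel s (x - y)))
        - P * (LINT y|lebesgue. indicator {y. lam \<le> y $ 1} y * frac_kernel s (x - y))"
        by (rule pv_integral_upper_bound[OF s \<gamma>(2) pv(1) anti r(1) dx(1,2) \<epsilon> _ P A0 bspec[OF touch] far wxP v])
           (use \<delta> in auto)
      also have "\<dots> \<le> A * (N * r powr (2 - 2 * s)) + 2 * \<epsilon> * P * (T * ?R)
          + (4 * \<delta>) * P * (T' * r powr (\<gamma> - 2 * s)) - P * (m * ?R)"
        using N[rule_format, OF r(1), of x] T[rule_format, OF r(1), of x] T'[rule_format, OF r(1), of x]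
          m[rule_format, OF r(1) dx(3,2)] A0 \<epsilon> \<delta> P
        by (intro diff_mono add_mono mult_left_mono) auto
      also have "A * (N * r powr (2 - 2 * s)) = P * (3 * \<epsilon> * N) * ?R"
      proof -
        have "r powr (2 - 2 * s) = r\<^sup>2 * ?R"
          using r(1) by (simp add: powr_diff powr_minus divide_inverse)
        then have "A * (N * r powr (2 - 2 * s)) = (A * r\<^sup>2) * N * ?R" by simp
        then show ?thesis unfolding A by (simp add: mult_ac)
      qed
      also have "(4 * \<delta>) * P * (T' * r powr (\<gamma> - 2 * s)) \<le> P * (m / 4) * ?R"
      proof -
        have "r powr (\<gamma> - 2 * s) \<le> ?R"
          using r l \<gamma> by (intro powr_mono') auto
        then have "P * (4 * \<delta> * T') * r powr (\<gamma> - 2 * s) \<le> P * (m / 4) * ?R"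
          using \<delta>T \<delta> \<open>0 < T'\<close> \<open>0 < m\<close> P by (intro mult_mono) auto
        then show ?thesis by (simp add: mult_ac)
      qed
      also have "P * (3 * \<epsilon> * N) * ?R + 2 * \<epsilon> * P * (T * ?R) + P * (m / 4) * ?R - P * (m * ?R)
          = P * ?R * ((3 * \<epsilon> * N + 2 * \<epsilon> * T) - 3 / 4 * m)"
        by (simp add: algebra_simps)
      also have "\<dots> \<le> P * ?R * (m / 4 - 3 / 4 * m)"
        using \<epsilon>NT P by (intro mult_left_mono) auto
      finally show ?thesis by (simp add: algebra_simps)
    qed
    have "\<kappa> * ?I = - (c x * w x)"
      using eq[OF x(1)] pv(2) by (simp add: \<kappa>_def)
    moreover have "- (2 * P * \<bar>C\<bar>) \<le> - (c x * w x)"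
    proof -
      have "- P * (1 + 2 * \<epsilon>) \<le> w x"
        using x(2) r(1) by (intro low_near) (simp add: dist_norm norm_minus_commute)
      moreover have "P * (1 + 2 * \<epsilon>) \<le> P * 2" using P \<epsilon> by (intro mult_left_mono) auto
      ultimately have "- w x \<le> 2 * P" by simp
      then have "\<bar>C\<bar> * - w x \<le> \<bar>C\<bar> * (2 * P)" by (intro mult_left_mono) auto
      moreover have "- \<bar>C\<bar> * - w x \<le> c x * - w x"
        using c x(1) wx by (intro mult_right_mono) force+
      ultimately show ?thesis by (simp add: mult_ac)
    qed
    moreover have "\<kappa> * ?I \<le> \<kappa> * (- P * (m / 2) * r powr - (2 * s))"
      using I \<kappa> by (intro mult_left_mono) auto
    ultimately have "P * (\<kappa> * (m / 2) * r powr - (2 * s)) \<le> P * (2 * \<bar>C\<bar>)"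
      by (simp add: mult_ac)
    then have "\<kappa> * (m / 2) * r powr - (2 * s) \<le> 2 * \<bar>C\<bar>"
      using P by simp
    then have "k * r powr - (2 * s) \<le> \<bar>C\<bar>" by (simp add: k_def)
    then have "k * r powr - (2 * s) * r powr (2 * s) \<le> \<bar>C\<bar> * r powr (2 * s)"
      by (intro mult_right_mono) auto
    then have "k \<le> \<bar>C\<bar> * r powr (2 * s)"
      using r(1) by (simp add: powr_minus mult.assoc)
    also have "\<dots> \<le> \<bar>C\<bar> * l powr (2 * s)"
      using r s by (intro mult_left_mono powr_mono2) auto
    finally show "k \<le> \<bar>C\<bar> * l powr (2 * s)" .
  qed
qed

theorem proposition1p3:
  fixes s C :: real
  assumes "0 < s" and "s < 1"
  shows "\<exists>l0>0. \<forall>l lam \<gamma>. \<forall>(\<Omega> :: (real ^ ('n::{finite,one})) set) (w :: real ^ ('n::{finite,one}) \<Rightarrow> real) (c :: real ^ ('n::{finite,one}) \<Rightarrow> real).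
     0 < l \<and> l < l0 \<and>
     open \<Omega> \<and> \<Omega> \<subseteq> {x. lam - 2 * l < x $ 1 \<and> x $ 1 < lam} \<and>
     w \<in> C11_loc \<Omega> \<inter> L_frac s \<and>
     lower_semicontinuous_on (closure \<Omega>) w \<and>
     0 < \<gamma> \<and> \<gamma> < 2 * s \<and>
     (\<exists>\<eta>. (\<eta> \<longlongrightarrow> 0) at_infinity \<and> (\<forall>\<^sub>F x in at_infinity. w x \<le> \<eta> x * norm x powr \<gamma>)) \<and>
     (\<forall>x\<in>\<Omega>. frac_laplacian s w x + c x * w x = 0) \<and>
     (\<forall>x\<in>half_space lam - \<Omega>. 0 \<le> w x) \<and>
     (\<forall>x\<in>half_space lam. w (reflect lam x) = - w x) \<and>
     (\<forall>x\<in>\<Omega>. C \<le> c x)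
     \<longrightarrow> (\<forall>x\<in>half_space lam. 0 \<le> w x) \<and>
         ((\<forall>x\<in>\<Omega>. 0 < w x) \<or> (\<forall>x\<in>\<Omega>. w x = 0))"
proof -
  obtain k where k: "0 < k" and width:
    "\<forall>(\<gamma> :: real) lam l (\<Omega> :: (real, 'n) vec set) w c C.
      narrow_problem s \<gamma> lam l \<Omega> w c \<longrightarrow> 0 < l \<longrightarrow> l \<le> 1 \<longrightarrow> (\<forall>x\<in>\<Omega>. C \<le> c x) \<longrightarrow>
      (\<exists>x\<in>half_space lam. w x < 0) \<longrightarrow> k \<le> \<bar>C\<bar> * l powr (2 * s)"
    using negative_value_needs_width[OF assms, where 'n = 'n] by (elim exE conjE) (rule that)
  define l0 where "l0 = min 1 ((k / (\<bar>C\<bar> + 1)) powr (1 / (2 * s)))"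
  have l0: "0 < l0" using k by (auto simp: l0_def)
  have small: "\<bar>C\<bar> * l powr (2 * s) < k" if l: "0 < l" "l < l0" for l
  proof -
    have "l powr (2 * s) < ((k / (\<bar>C\<bar> + 1)) powr (1 / (2 * s))) powr (2 * s)"
      using l assms(1) by (intro powr_less_mono2) (auto simp: l0_def)
    also have "\<dots> = k / (\<bar>C\<bar> + 1)"
      using assms(1) k by (simp add: powr_powr)
    finally have "(\<bar>C\<bar> + 1) * l powr (2 * s) < k" by (simp add: pos_less_divide_eq mult.commute)
    moreover have "\<bar>C\<bar> * l powr (2 * s) \<le> (\<bar>C\<bar> + 1) * l powr (2 * s)"
      by (intro mult_right_mono) auto
    ultimately show ?thesis by linarith
  qed
  show ?thesis
  proof (rule exI[of _ l0], rule conjI[OF l0], intro allI impI, elim conjE exE)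
    fix l lam \<gamma> :: real and \<Omega> :: "(real, 'n) vec set" and w c \<eta> :: "(real, 'n) vec \<Rightarrow> real"
    assume l: "0 < l" "l < l0"
      and \<Omega>: "open \<Omega>" "\<Omega> \<subseteq> {x. lam - 2 * l < x $ 1 \<and> x $ 1 < lam}"
      and w: "w \<in> C11_loc \<Omega> \<inter> L_frac s" and lsc: "lower_semicontinuous_on (closure \<Omega>) w"
      and \<gamma>: "0 < \<gamma>" "\<gamma> < 2 * s"
      and \<eta>: "(\<eta> \<longlongrightarrow> 0) at_infinity" "\<forall>\<^sub>F x in at_infinity. w x \<le> \<eta> x * norm x powr \<gamma>"
      and eq: "\<forall>x\<in>\<Omega>. frac_laplacian s w x + c x * w x = 0"
      and out: "\<forall>x\<in>half_space lam - \<Omega>. 0 \<le> w x"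
      and anti: "\<forall>x\<in>half_space lam. w (reflect lam x) = - w x"
      and c: "\<forall>x\<in>\<Omega>. C \<le> c x"
    have "\<forall>\<^sub>F x in at_infinity. \<eta> x < 1"
      using \<eta>(1) by (rule order_tendstoD) simp
    with \<eta>(2) have "\<forall>\<^sub>F x in at_infinity. w x \<le> norm x powr \<gamma>"
    proof eventually_elim
      case (elim x)
      have "\<eta> x * norm x powr \<gamma> \<le> 1 * norm x powr \<gamma>"
        using elim(2) by (intro mult_right_mono) auto
      with elim(1) show ?case by simp
    qed
    with \<Omega> w lsc \<gamma> eq out anti have prob: "narrow_problem s \<gamma> lam l \<Omega> w c"
      unfolding narrow_problem_def by blast
    have pos: "\<forall>x\<in>half_space lam. 0 \<le> w x"
    proof (rule ccontr)
      assume "\<not> (\<forall>x\<in>half_space lam. 0 \<le> w x)"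
      then have "\<exists>x\<in>half_space lam. w x < 0" by (auto simp: not_le)
      moreover have "l \<le> 1" using l(2) by (simp add: l0_def)
      ultimately have "k \<le> \<bar>C\<bar> * l powr (2 * s)"
        using width[rule_format, OF prob l(1) _ bspec[OF c]] by blast
      with small[OF l] show False by simp
    qed
    have half: "\<Omega> \<subseteq> half_space lam" using \<Omega>(2) by (auto simp: half_space_def)
    have "(\<forall>x\<in>\<Omega>. 0 < w x) \<or> (\<forall>x\<in>\<Omega>. w x = 0)"
    proof (cases "\<forall>x\<in>\<Omega>. 0 < w x")
      case False
      then obtain x where x: "x \<in> \<Omega>" "\<not> 0 < w x" by blast
      have "0 \<le> w x" using pos half x(1) by blast
      then have wx: "w x = 0" using x(2) by simp
      have lap: "frac_laplacian s w x = 0" using bspec[OF eq x(1)] wx by simp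
      have "\<forall>y\<in>\<Omega>. w y = 0"
        using strong_maximum_principle[OF assms IntD1[OF w] IntD2[OF w] \<Omega>(1) half
            bspec[OF pos] bspec[OF anti] x(1) wx lap] by blast
      then show ?thesis by blast
    qed blast
    with pos show "(\<forall>x\<in>half_space lam. 0 \<le> w x) \<and> ((\<forall>x\<in>\<Omega>. 0 < w x) \<or> (\<forall>x\<in>\<Omega>. w x = 0))"
      by blast
  qed
qed

end
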